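(* Let $n\ge 1$ be an integer and let $m=\prod_{i=1}^s p_i^{\alpha_i}$, where $s\ge 1$, $3\le p_1<p_2<\cdots<p_s$ are odd primes and all $\alpha_i$ are positive integers. If an $(m,n)$-generalized bent function exists, then $s\ge 2$ and $3p_1+p_2\le 2^n$.
   Context: For integers $m\ge 2$ and $n\ge 1$, put $\zeta_m=e^{2\pi\sqrt{-1}/m}$. A function $f:\mathbb{Z}_2^n\to\mathbb{Z}_m$ (where $\mathbb{Z}_m=\mathbb{Z}/m\mathbb{Z}$) is called an $(m,n)$-generalized bent function ($(m,n)$-GBF) if $|F(y)|^2=2^n$ for all $y\in\mathbb{Z}_2^n$, where $F(y)=\sum_{x\in\mathbb{Z}_2^n}\zeta_m^{f(x)}(-1)^{y\cdot x}$ and $y\cdot x$ is the usual inner product. *)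

theory Defs
  imports
    "HOL-Analysis.Analysis"
    "HOL-Number_Theory.Number_Theory"
begin

definition zeta :: "nat \<Rightarrow> complex" where
  "zeta m = exp (2 * of_real pi * \<i> / of_nat m)"

(* Residue classes modulo k are represented by 0, ..., k - 1, the carrier of residue_ring k.
   Vectors are extensional functions (undefined outside {..<n}), so that each element of
   Z_2^n is represented exactly once. *)
definition Z2vec :: "nat \<Rightarrow> (nat \<Rightarrow> int) set" where
  "Z2vec n = {..<n} \<rightarrow>\<^sub>E carrier (residue_ring 2)"

definition inner2 :: "nat \<Rightarrow> (nat \<Rightarrow> int) \<Rightarrow> (nat \<Rightarrow> int) \<Rightarrow> int" where
  "inner2 n y x = (\<Sum>i<n. y i * x i) mod 2"

definition gbf_transform ::
  "nat \<Rightarrow> nat \<Rightarrow> ((nat \<Rightarrow> int) \<Rightarrow> int) \<Rightarrow> (nat \<Rightarrow> int) \<Rightarrow> complex" where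
  "gbf_transform m n f y =
     (\<Sum>x\<in>Z2vec n. zeta m powi f x * (-1) powi inner2 n y x)"

definition is_GBF :: "nat \<Rightarrow> nat \<Rightarrow> ((nat \<Rightarrow> int) \<Rightarrow> int) \<Rightarrow> bool" where
  "is_GBF m n f \<longleftrightarrow>
     f \<in> Z2vec n \<rightarrow> carrier (residue_ring (int m)) \<and>
     (\<forall>y\<in>Z2vec n. (cmod (gbf_transform m n f y))\<^sup>2 = 2 ^ n)"

end

theory Submission
  imports Defs "HOL-Computational_Algebra.Squarefree"
begin

text \<open>
  For \<open>a \<noteq> 0\<close> the bent property makes \<open>\<Sum>x. \<zeta>\<^sub>m ^ (f x - f (x + a))\<close> a vanishing sum of \<open>2 ^ n\<close> roots
  of unity whose multiset of exponents is symmetric. As in the theory of Lam and Leung, a vanishing sum of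
  length less than \<open>3 p\<^sub>1 + p\<^sub>2\<close> is a sum of cosets of subgroups of prime order. Since \<open>2 ^ n\<close> is
  even and no multiple of an odd prime, there are exactly two cosets, of different prime orders
  \<open>r\<close> and \<open>s\<close>, and by symmetry they are the subgroups themselves. So all differences
  \<open>f x - f x'\<close> have prime order or vanish, which forces them into a single subgroup of prime
  order; but both \<open>r\<close> and \<open>s\<close> occur.
\<close>

subsection \<open>Conjugates of roots of unity\<close>

hide_const (open) Module.smult UnivPoly.monom UnivPoly.coeff

text \<open>That short vanishing sums split into cosets is a matter of length: once three odd primes
  divide \<open>m\<close>, there are vanishing sums without any coset. With e_n a primitive n-th
  root of unity, (e_3 + e_3^2)(e_5 + ... + e_5^4) + (e_7 + ... + e_7^6) = (-1)(-1) + (-1) = 0 is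
  one, with 8 + 6 = 14 = 3 * 3 + 5 terms, so the constant \<open>3 * a + b\<close> has no slack
  there. The tool is slicing: Galois conjugation turns a vanishing sum modulo \<open>p * q\<close>
  into \<open>p\<close> sums modulo \<open>q\<close> of a common value. That value is zero when
  \<open>p\<close> divides \<open>q\<close> but need not be zero otherwise, and this is the
  obstacle. It is met by comparing two nonnegative sums of equal value: unless the first multiset
  lies in the second, the second must be long. The estimates see only \<open>a\<close>, standing for
  the least prime, and a lower bound \<open>b\<close> for the other primes, so that a prime power
  can be treated with \<open>b\<close> as large as desired.\<close>

definition int_eval :: "complex \<Rightarrow> int poly \<Rightarrow> complex" where
  "int_eval z Q = poly (map_poly of_int Q) z"

lemma int_eval_0 [simp]: "int_eval z 0 = 0"
  by (simp add: int_eval_def)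

lemma int_eval_pCons [simp]: "int_eval z (pCons a Q) = of_int a + z * int_eval z Q"
  by (simp add: int_eval_def map_poly_pCons)

lemma int_eval_1 [simp]: "int_eval z 1 = 1"
  by (simp add: one_pCons)

lemma int_eval_add [simp]: "int_eval z (P + Q) = int_eval z P + int_eval z Q"
  by (induction P Q rule: poly_induct2) (simp_all add: algebra_simps)

lemma int_eval_uminus [simp]: "int_eval z (- Q) = - int_eval z Q"
  by (induction Q) simp_all

lemma int_eval_diff [simp]: "int_eval z (P - Q) = int_eval z P - int_eval z Q"
  using int_eval_add[of z P "- Q"] by simp

lemma int_eval_smult [simp]: "int_eval z (smult c Q) = of_int c * int_eval z Q"
  by (induction Q) (simp_all add: algebra_simps)

lemma int_eval_mult [simp]: "int_eval z (P * Q) = int_eval z P * int_eval z Q"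
  by (induction P) (simp_all add: algebra_simps)

lemma int_eval_power [simp]: "int_eval z (P ^ n) = int_eval z P ^ n"
  by (induction n) simp_all

lemma int_eval_monom [simp]: "int_eval z (monom c n) = of_int c * z ^ n"
  by (induction n) (simp_all add: monom_0 monom_Suc algebra_simps)

lemma int_eval_sum [simp]: "int_eval z (sum F A) = (\<Sum>i\<in>A. int_eval z (F i))"
  by (induction A rule: infinite_finite_induct) simp_all

lemma int_eval_pcompose [simp]: "int_eval z (pcompose P Q) = int_eval (int_eval z Q) P"
  by (induction P) (simp_all add: pcompose_pCons)

text \<open>The inner binomial coefficients are multiples of \<open>p\<close>. The ring is arbitrary
  because the use is in \<open>int poly\<close>.\<close>

lemma prime_dvd_power_sum_diff:
  fixes x y :: "'a :: comm_ring_1"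
  assumes "prime p"
  shows "of_nat p dvd (x + y) ^ p - (x ^ p + y ^ p)"
proof -
  have p: "p \<ge> 2" using assms by (rule prime_ge_2_nat)
  have "(x + y) ^ p = (\<Sum>k\<in>insert 0 (insert p {1..<p}). of_nat (p choose k) * x ^ k * y ^ (p - k))"
    unfolding binomial_ring by (rule sum.cong) auto
  also have "\<dots> = y ^ p + (x ^ p + (\<Sum>k\<in>{1..<p}. of_nat (p choose k) * x ^ k * y ^ (p - k)))"
    using p by (subst sum.insert) auto
  finally have "(x + y) ^ p - (x ^ p + y ^ p) = (\<Sum>k\<in>{1..<p}. of_nat (p choose k) * x ^ k * y ^ (p - k))"
    by simp
  moreover have "of_nat p dvd (of_nat (p choose k) * x ^ k * y ^ (p - k) :: 'a)" if "k \<in> {1..<p}" for k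
  proof -
    have "p dvd (p choose k)" using that assms by (intro dvd_choose_prime) auto
    then obtain c where "p choose k = p * c" ..
    then show ?thesis by (simp add: mult.assoc)
  qed
  ultimately show ?thesis by (simp only: dvd_sum)
qed

lemma int_fermat_dvd:
  fixes a :: int
  assumes "prime p"
  shows "int p dvd a ^ p - a"
proof (cases "int p dvd a")
  case True
  then have "int p dvd a ^ p" using prime_gt_0_nat[OF assms] by (intro dvd_trans[OF True dvd_power]) simp
  then show ?thesis using True by (rule dvd_diff)
next
  case False
  define b where "b = nat (a mod int p)"
  have p: "int p > 0" using prime_gt_0_nat[OF assms] by simp
  have b: "int b = a mod int p" using p by (simp add: b_def)
  have "\<not> p dvd b" using False b by (metis dvd_mod_iff dvd_refl int_dvd_int_iff)
  from fermat_theorem[OF assms this] have "[int b ^ (p - 1) = 1] (mod int p)"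
    by (metis cong_int_iff of_nat_1 of_nat_power)
  then have "[int b ^ (p - 1) * int b = 1 * int b] (mod int p)" by (rule cong_scalar_right)
  then have "[int b ^ p = int b] (mod int p)"
    using prime_gt_0_nat[OF assms] by (simp add: power_eq_if mult.commute)
  then have "[a ^ p = a] (mod int p)"
    unfolding b by (simp add: cong_def power_mod)
  then show ?thesis by (simp add: cong_iff_dvd_diff)
qed

text \<open>Over F_p the p-th power is additive and fixes constants, so Q^p = Q(X^p); the latter is
  \<open>pcompose Q (monom 1 p)\<close>.\<close>

lemma int_poly_frobenius:
  fixes Q :: "int poly"
  assumes "prime p"
  shows "[:int p:] dvd Q ^ p - pcompose Q (monom 1 p)"
proof (induction Q)
  case 0
  then show ?case using prime_gt_0_nat[OF assms] by (simp add: power_0_left)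
next
  case (pCons a Q)
  have of_nat: "of_nat p = [:int p:]" by (simp add: of_nat_poly)
  have "pCons a Q = [:a:] + [:0,1:] * Q" by simp
  then have 1: "[:int p:] dvd pCons a Q ^ p - ([:a:] ^ p + ([:0,1:] * Q) ^ p)"
    using prime_dvd_power_sum_diff[OF assms, of "[:a:]" "[:0,1:] * Q"] unfolding of_nat by simp
  have "[:a:] ^ p - [:a:] = [:a ^ p - a:]" by (simp add: poly_const_pow)
  then have 2: "[:int p:] dvd [:a:] ^ p - [:a:]"
    using int_fermat_dvd[OF assms, of a] by (simp only: const_poly_dvd_const_poly_iff)
  have 3: "[:int p:] dvd monom 1 p * (Q ^ p - pcompose Q (monom 1 p))"
    using pCons.IH by simp
  have "([:0,1:] * Q) ^ p = monom 1 p * Q ^ p"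
    by (simp only: power_mult_distrib monom_altdef smult_1_left)
  then have "pCons a Q ^ p - pcompose (pCons a Q) (monom 1 p) =
     (pCons a Q ^ p - ([:a:] ^ p + ([:0,1:] * Q) ^ p)) + ([:a:] ^ p - [:a:]) +
     monom 1 p * (Q ^ p - pcompose Q (monom 1 p))"
    by (simp add: pcompose_pCons algebra_simps)
  then show ?case using 1 2 3 by (metis dvd_add)
qed

text \<open>The primitive part of an annihilator of least degree works: pseudo-division and Gauss's
  lemma give divisibility over the integers, where reduction modulo \<open>p\<close> makes
  sense.\<close>

lemma minimal_int_poly:
  assumes "Q0 \<noteq> 0" "int_eval z Q0 = 0"
  obtains f :: "int poly" where "f \<noteq> 0" "int_eval z f = 0"
    "\<And>Q. int_eval z Q = 0 \<Longrightarrow> f dvd Q"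
proof -
  define S where "S = {Q :: int poly. Q \<noteq> 0 \<and> int_eval z Q = 0}"
  obtain g where g: "g \<in> S" "\<And>Q. Q \<in> S \<Longrightarrow> degree g \<le> degree Q"
    using ex_has_least_nat[of "\<lambda>Q. Q \<in> S" Q0 degree] assms by (auto simp: S_def)
  define f where "f = primitive_part g"
  have g0: "g \<noteq> 0" "int_eval z g = 0" using g by (auto simp: S_def)
  have "int_eval z g = of_int (content g) * int_eval z f"
    by (metis content_times_primitive_part f_def int_eval_smult)
  then have f: "f \<noteq> 0" "int_eval z f = 0" "content f = 1" "degree f = degree g"
    using g0 by (auto simp: f_def)
  show ?thesis
  proof (rule that[OF f(1,2)])
    fix Q assume Q: "int_eval z Q = 0"
    obtain a q where aq: "a \<noteq> 0" "smult a Q = f * q + pseudo_mod Q f"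
      using pseudo_mod(1)[OF f(1)] by metis
    have "int_eval z (smult a Q) = int_eval z (f * q) + int_eval z (pseudo_mod Q f)"
      by (simp add: aq)
    then have "int_eval z (pseudo_mod Q f) = 0" using Q f by simp
    then have "pseudo_mod Q f = 0 \<or> degree g \<le> degree (pseudo_mod Q f)"
      using g(2)[of "pseudo_mod Q f"] by (auto simp: S_def)
    then have "pseudo_mod Q f = 0"
      using pseudo_mod(2)[OF f(1), of Q] f(4) by linarith
    then have "f dvd smult a Q" using aq by simp
    then have "primitive_part f dvd primitive_part (smult a Q)" by blast
    then have "f dvd smult (unit_factor a) (primitive_part Q)"
      by (simp add: primitive_part_prim f primitive_part_smult)
    \<comment> \<open>\<open>unit_factor a\<close> is a sign, so applying it twice removes
      it.\<close>
    then have "f dvd smult (unit_factor a) (smult (unit_factor a) (primitive_part Q))"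
      by (rule dvd_smult)
    then have "f dvd primitive_part Q" using aq(1) by (simp add: sgn_if split: if_splits)
    then show "f dvd Q" by (metis content_times_primitive_part dvd_smult)
  qed
qed

text \<open>If \<open>X ^ m - 1 = f * g\<close> and \<open>f (z ^ p) \<noteq> 0\<close>, then differentiating at \<open>z ^ p\<close> shows that
  \<open>f (z ^ p)\<close>, a multiple of \<open>p\<close> in \<open>\<int>[z]\<close>, divides \<open>m\<close> there.\<close>
lemma int_eval_prime_power_eq_0:
  assumes z: "z ^ m = 1" and m: "m > 0" and p: "prime p" "\<not> p dvd m" and Q: "int_eval z Q = 0"
  shows "int_eval (z ^ p) Q = 0"
proof -
  define U where "U = (monom 1 m - 1 :: int poly)"
  have "coeff U m = 1" using m by (simp add: U_def)
  then have U0: "U \<noteq> 0" by auto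
  have Uz: "int_eval z U = 0" using z by (simp add: U_def)
  obtain f where f: "f \<noteq> 0" "int_eval z f = 0" "\<And>Q. int_eval z Q = 0 \<Longrightarrow> f dvd Q"
    using minimal_int_poly[OF U0 Uz] by blast
  obtain g where g: "U = f * g" using f(3)[OF Uz] ..
  have "lead_coeff U = 1"
  proof -
    have "degree U = m" unfolding U_def
      by (rule antisym) (use m in \<open>auto intro!: degree_le le_degree simp: coeff_eq_0\<close>)
    then show ?thesis using \<open>coeff U m = 1\<close> by simp
  qed
  \<comment> \<open>A unit leading coefficient will let divisibility by \<open>p\<close> pass from
    \<open>f * h\<close> to \<open>h\<close>.\<close>
  then have "lead_coeff f * lead_coeff g = 1" unfolding g lead_coeff_mult .
  then have lead: "lead_coeff f = 1 \<or> lead_coeff f = -1" using pos_zmult_eq_1_iff_lemma by blast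
  have "int_eval (z ^ p) f = 0"
  proof (rule ccontr)
    assume nz: "int_eval (z ^ p) f \<noteq> 0"
    have zp: "(z ^ p) ^ m = 1" using z by (metis mult.commute power_mult power_one)
    then have "int_eval (z ^ p) U = 0" by (simp add: U_def)
    then have g0: "int_eval (z ^ p) g = 0" using nz by (simp add: g)
    have "pderiv U = monom (int m) (m - 1)" by (simp add: U_def pderiv_diff pderiv_monom)
    then have "int_eval (z ^ p) (f * pderiv g + g * pderiv f) = of_nat m * (z ^ p) ^ (m - 1)"
      by (simp add: g pderiv_mult)
    then have "int_eval (z ^ p) f * int_eval (z ^ p) (pderiv g) = of_nat m * (z ^ p) ^ (m - 1)"
      using g0 by simp
    then have "z ^ p * (int_eval (z ^ p) f * int_eval (z ^ p) (pderiv g)) = of_nat m * (z ^ p) ^ m"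
      using m by (simp add: power_eq_if)
    then have 1: "z ^ p * (int_eval (z ^ p) f * int_eval (z ^ p) (pderiv g)) = of_nat m"
      using zp by simp
    obtain R where R: "f ^ p - pcompose f (monom 1 p) = [:int p:] * R"
      using int_poly_frobenius[OF p(1)] ..
    have "int_eval z (f ^ p - pcompose f (monom 1 p)) = of_nat p * int_eval z R"
      by (simp add: R)
    then have 2: "int_eval (z ^ p) f = - of_nat p * int_eval z R"
      using f(2) prime_gt_0_nat[OF p(1)] by (simp add: power_0_left) (metis minus_minus)
    \<comment> \<open>Inserting fact 2 into fact 1 shows that \<open>m\<close> is \<open>p\<close>
      times the value of \<open>S\<close> at \<open>z\<close>; the factor \<open>pderiv g\<close> at
      \<open>z ^ p\<close> is \<open>pcompose (pderiv g) (monom 1 p)\<close> at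
      \<open>z\<close>.\<close>
    define S where "S = - (monom 1 p * R * pcompose (pderiv g) (monom 1 p))"
    have 3: "int_eval z ([:int m:] - [:int p:] * S) = 0"
      using 1 unfolding S_def 2 by (simp add: algebra_simps) (metis add.left_inverse)
    then obtain h where h: "[:int m:] - [:int p:] * S = f * h" using f(3) by blast
    \<comment> \<open>Modulo \<open>p\<close> the constant \<open>m\<close> is a multiple of \<open>f\<close>, whose leading coefficient is a unit.\<close>
    have deg: "degree f > 0"
    proof (rule ccontr)
      assume "\<not> degree f > 0"
      then obtain c where "f = [:c:]" by (metis degree_eq_zeroE gr0I)
      then show False using f(1,2) by simp
    qed
    have "int p dvd coeff h i" for i
    \<comment> \<open>Downward induction: the coefficient of \<open>f * h\<close> at
      \<open>i + degree f\<close> is \<open>lead_coeff f * coeff h i\<close> plus terms with higher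
      coefficients of \<open>h\<close>.\<close>
    proof (induction "degree h + 1 - i" arbitrary: i rule: less_induct)
      case less
      show ?case
      proof (cases "i > degree h")
        case True
        then show ?thesis by (simp add: coeff_eq_0)
      next
        case False
        have "coeff (f * h) (i + degree f) = (\<Sum>j\<le>i + degree f. coeff f j * coeff h (i + degree f - j))"
          by (simp add: coeff_mult)
        also have "\<dots> = coeff f (degree f) * coeff h i +
            (\<Sum>j\<in>{..i + degree f} - {degree f}. coeff f j * coeff h (i + degree f - j))"
          by (subst sum.remove[of _ "degree f"]) auto
        finally have eq: "coeff (f * h) (i + degree f) = \<dots>" .
        have "int p dvd coeff f j * coeff h (i + degree f - j)" if "j \<noteq> degree f" for j
        proof (cases "j > degree f")
          case True
          then show ?thesis by (simp add: coeff_eq_0)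
        next
          case False
          then have "int p dvd coeff h (i + degree f - j)"
            using that \<open>\<not> i > degree h\<close> by (intro less) auto
          then show ?thesis by simp
        qed
        then have 4: "int p dvd (\<Sum>j\<in>{..i + degree f} - {degree f}. coeff f j * coeff h (i + degree f - j))"
          by (intro dvd_sum) auto
        \<comment> \<open>The index is positive, so the constant \<open>m\<close> does not
          contribute.\<close>
        have "coeff (f * h) (i + degree f) = - (int p * coeff S (i + degree f))"
          using deg unfolding h[symmetric] by (simp add: coeff_pCons split: nat.split)
        then have "int p dvd lead_coeff f * coeff h i"
          using 4 unfolding eq by (smt (verit) dvd_add_left_iff dvd_minus_iff dvd_triv_left)
        then show ?thesis using lead by auto
      qed
    qed
    then have "[:int p:] dvd h" by (simp add: const_poly_dvd_iff)
    then have "[:int p:] dvd f * h + [:int p:] * S" by (intro dvd_add dvd_mult dvd_triv_left)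
    then have "[:int p:] dvd [:int m:]" unfolding h[symmetric] by simp
    then show False using p(2) by simp
  qed
  then show ?thesis using f(3)[OF Q] by (auto elim!: dvdE)
qed

text \<open>The primes of \<open>k\<close> are peeled off one at a time, each replacing
  \<open>z\<close> by another m-th root of unity; hence \<open>z\<close> stays arbitrary in the
  induction. This plays the part of the Galois action.\<close>

theorem int_eval_coprime_power_eq_0:
  assumes "z ^ m = 1" "m > 0" "coprime k m" "int_eval z Q = 0"
  shows "int_eval (z ^ k) Q = 0"
  using assms
proof (induction k arbitrary: z rule: prime_divisors_induct)
  case zero
  then show ?case by simp
next
  case (unit x)
  then show ?case by simp
next
  case (factor p k)
  have "(z ^ p) ^ m = 1" using factor.prems by (metis mult.commute power_mult power_one)
  moreover have "\<not> p dvd m" using factor.hyps factor.prems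
    by (metis coprime_common_divisor dvd_triv_left not_prime_unit)
  then have "int_eval (z ^ p) Q = 0"
    using factor by (intro int_eval_prime_power_eq_0) auto
  ultimately show ?case using factor by (simp add: power_mult)
qed

subsection \<open>Slicing vanishing sums\<close>

definition uroot :: "nat \<Rightarrow> int \<Rightarrow> complex" where
  "uroot m j = cis (2 * pi * real_of_int j / real m)"

lemma uroot_add: "uroot m (i + j) = uroot m i * uroot m j"
  by (simp add: uroot_def cis_mult add_divide_distrib distrib_left)

lemma uroot_0 [simp]: "uroot m 0 = 1"
  by (simp add: uroot_def)

lemma uroot_power: "uroot m j ^ k = uroot m (int k * j)"
  by (simp only: uroot_def Complex.DeMoivre) (simp add: mult_ac)

lemma uroot_self_mult: "m > 0 \<Longrightarrow> uroot m (int m * j) = 1"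
  using cis_multiple_2pi[of "of_int j"] by (simp add: uroot_def mult.assoc)

lemma uroot_mult_cancel: "p > 0 \<Longrightarrow> uroot (p * q) (int p * j) = uroot q j"
  by (simp add: uroot_def mult.assoc)

lemma uroot_mult_cancel': "q > 0 \<Longrightarrow> uroot (p * q) (int q * j) = uroot p j"
  by (simp add: uroot_def mult.assoc)

lemma uroot_cong:
  assumes "m > 0" "[i = j] (mod int m)"
  shows "uroot m i = uroot m j"
proof -
  obtain k where "i = j + int m * k" using assms(2) by (metis cong_iff_lin cong_sym)
  then show ?thesis using assms(1) by (simp add: uroot_add uroot_self_mult)
qed

lemma uroot_eq_1_iff:
  assumes "m > 0"
  shows "uroot m j = 1 \<longleftrightarrow> int m dvd j"
proof
  assume "uroot m j = 1"
  then have "cos (2 * pi * real_of_int j / real m) = 1" by (simp add: uroot_def complex_eq_iff)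
  then obtain n :: int where "2 * pi * real_of_int j / real m = of_int n * 2 * pi"
    using cos_one_2pi_int by blast
  then have "real_of_int j = of_int (n * int m)" using assms by (simp add: field_simps)
  then have "j = n * int m" by linarith
  then show "int m dvd j" by simp
qed (auto simp: uroot_self_mult assms elim!: dvdE)

lemma sum_uroot:
  assumes "m > 0"
  shows "(\<Sum>r<m. uroot m (int r * j)) = (if int m dvd j then of_nat m else 0)"
proof (cases "int m dvd j")
  case True
  then have "uroot m (int r * j) = 1" for r using uroot_eq_1_iff[OF assms] by simp
  then show ?thesis using True by simp
next
  case False
  then have "uroot m j \<noteq> 1" using uroot_eq_1_iff[OF assms] by simp
  moreover have "uroot m j ^ m = 1" using assms by (simp add: uroot_power uroot_self_mult)
  ultimately show ?thesis using False by (simp flip: uroot_power add: geometric_sum)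
qed

text \<open>Fourier inversion on Z_p: weighting frequency \<open>r\<close> by the conjugate
  character at \<open>h\<close> and summing isolates \<open>c h\<close>, and only
  \<open>r = 0\<close> contributes.\<close>

lemma fourier_constant:
  assumes "p > 0" "\<And>r. r \<in> {1..<p} \<Longrightarrow> (\<Sum>h<p. uroot p (int r * int h) * c h) = 0" "h < p"
  shows "of_nat p * c h = (\<Sum>h<p. c h)"
proof -
  have "(\<Sum>r<p. uroot p (- (int r * int h)) * (\<Sum>k<p. uroot p (int r * int k) * c k))
      = (\<Sum>r\<in>{0}. uroot p (- (int r * int h)) * (\<Sum>k<p. uroot p (int r * int k) * c k))"
    using assms(1,2) by (intro sum.mono_neutral_right) auto
  then have "(\<Sum>k<p. c k) = (\<Sum>r<p. uroot p (- (int r * int h)) * (\<Sum>k<p. uroot p (int r * int k) * c k))"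
    by simp
  also have "\<dots> = (\<Sum>r<p. \<Sum>k<p. uroot p (int r * (int k - int h)) * c k)"
    by (simp add: sum_distrib_left right_diff_distrib' mult_ac flip: uroot_add)
  also have "\<dots> = (\<Sum>k<p. (\<Sum>r<p. uroot p (int r * (int k - int h))) * c k)"
    by (subst sum.swap) (simp add: sum_distrib_right)
  also have "\<dots> = (\<Sum>k<p. if k = h then of_nat p * c k else 0)"
  proof (rule sum.cong)
    fix k assume k: "k \<in> {..<p}"
    have "int p dvd int k - int h \<longleftrightarrow> k = h"
      using dvd_imp_le_int[of "int k - int h" "int p"] k assms(3) by (cases "k = h") auto
    then show "(\<Sum>r<p. uroot p (int r * (int k - int h))) * c k = (if k = h then of_nat p * c k else 0)"
      by (simp add: sum_uroot assms(1))
  qed simp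
  also have "\<dots> = of_nat p * c h" using assms(3) by simp
  finally show ?thesis ..
qed

text \<open>Functions on Z_m are kept as functions on all integers, so that shifts and negation need
  no reduction.\<close>

definition periodic :: "nat \<Rightarrow> (int \<Rightarrow> 'a) \<Rightarrow> bool" where
  "periodic m d \<longleftrightarrow> (\<forall>j. d (j + int m) = d j)"

lemma periodic_uroot: "m > 0 \<Longrightarrow> periodic m (uroot m)"
  by (auto simp: periodic_def cong_def intro!: uroot_cong)

lemma periodic_cong:
  assumes "periodic m d" "[i = j] (mod int m)"
  shows "d i = d j"
proof -
  have nat: "d (j + int n * int m) = d j" for j n
  proof (induction n)
    case (Suc n)
    have "d (j + int (Suc n) * int m) = d (j + int n * int m + int m)" by (simp add: algebra_simps)
    then show ?case using Suc assms(1) by (simp add: periodic_def)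
  qed simp
  obtain k where k: "i = j + int m * k" using assms(2) by (metis cong_iff_lin cong_sym)
  show ?thesis
  proof (cases "k \<ge> 0")
    case True
    then show ?thesis using nat[of j "nat k"] k by (simp add: mult.commute)
  next
    case False
    then show ?thesis using nat[of i "nat (- k)"] k by (simp add: algebra_simps)
  qed
qed

lemma sum_residues_crt:
  fixes F :: "int \<Rightarrow> 'a :: comm_monoid_add"
  assumes "coprime p q" "p > 0" "q > 0" "periodic (p * q) F"
  shows "(\<Sum>j<p * q. F (int j)) = (\<Sum>h<p. \<Sum>g<q. F (int h * int q + int p * int g))"
proof -
  define e where "e = (\<lambda>(h, g). (h * q + p * g) mod (p * q))"
  have "h = h' \<and> g = g'"
    if *: "h < p" "g < q" "h' < p" "g' < q" "e (h, g) = e (h', g')" for h g h' g'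
  proof -
    from * have c: "[h * q + p * g = h' * q + p * g'] (mod (p * q))" by (simp add: e_def cong_def)
    have "[h * q + p * g = h * q] (mod p)" "[h' * q + p * g' = h' * q] (mod p)"
      by (simp_all add: cong_def)
    then have "[h * q = h' * q] (mod p)"
      using cong_modulus_mult_nat[OF c] by (meson cong_sym cong_trans)
    then have "[h = h'] (mod p)" using assms(1) by (metis cong_mult_rcancel_nat coprime_commute)
    moreover have "[h * q + p * g = p * g] (mod q)" "[h' * q + p * g' = p * g'] (mod q)"
      by (simp_all add: cong_def)
    then have "[p * g = p * g'] (mod q)"
      using cong_modulus_mult_nat[of _ _ q p] c by (metis cong_sym cong_trans mult.commute)
    then have "[g = g'] (mod q)" using assms(1) by (metis cong_mult_lcancel_nat coprime_commute)
    ultimately show ?thesis using * by (auto simp: cong_def)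
  qed
  then have "inj_on e ({..<p} \<times> {..<q})" by (auto intro!: inj_onI)
  moreover have "e ` ({..<p} \<times> {..<q}) \<subseteq> {..<p * q}" using assms by (auto simp: e_def)
  ultimately have "bij_betw e ({..<p} \<times> {..<q}) {..<p * q}"
    by (metis bij_betw_def card_cartesian_product card_image card_lessThan card_subset_eq finite_lessThan)
  then have "(\<Sum>j<p * q. F (int j)) = (\<Sum>x\<in>{..<p} \<times> {..<q}. F (int (e x)))"
    by (rule sum.reindex_bij_betw[symmetric])
  also have "\<dots> = (\<Sum>(h, g)\<in>{..<p} \<times> {..<q}. F (int h * int q + int p * int g))"
  proof (rule sum.cong, simp, clarify)
    fix h g
    have "[int (e (h, g)) = int h * int q + int p * int g] (mod int (p * q))"
      by (simp add: e_def zmod_int)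
    then show "F (int (e (h, g))) = F (int h * int q + int p * int g)"
      by (rule periodic_cong[OF assms(4)])
  qed
  finally show ?thesis by (simp add: sum.cartesian_product)
qed

text \<open>The splitting for a repeated prime, where \<open>p\<close> and \<open>q\<close> are not
  coprime and the Chinese remainder coordinates fail.\<close>

lemma sum_residues_digits:
  fixes F :: "int \<Rightarrow> 'a :: comm_monoid_add"
  assumes "p > 0"
  shows "(\<Sum>j<p * q. F (int j)) = (\<Sum>h<p. \<Sum>g<q. F (int h + int p * int g))"
proof -
  have "(\<Sum>h<p. \<Sum>g<q. F (int h + int p * int g)) = (\<Sum>(h, g)\<in>{..<p} \<times> {..<q}. F (int h + int p * int g))"
    by (simp add: sum.cartesian_product)
  also have "\<dots> = (\<Sum>j<p * q. F (int j))"
  proof (rule sum.reindex_bij_witness[of _ "\<lambda>j. (j mod p, j div p)" "\<lambda>(h, g). h + p * g"]; clarsimp)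
    fix h g assume "h < p" "g < q"
    then have "h + p * g < p * Suc g" "p * Suc g \<le> p * q" by (simp_all del: mult_Suc_right) simp
    then show "h + p * g < p * q" by linarith
  next
    fix j assume "j < p * q"
    then show "j mod p < p \<and> j div p < q"
      using assms by (simp add: less_mult_imp_div_less mult.commute)
  qed
  finally show ?thesis ..
qed

section \<open>Integer combinations of roots of unity and their slices\<close>

definition root_sum :: "nat \<Rightarrow> (int \<Rightarrow> int) \<Rightarrow> complex" where
  "root_sum m d = (\<Sum>j<m. of_int (d (int j)) * uroot m (int j))"

lemma root_sum_diff: "root_sum m (\<lambda>j. x j - y j) = root_sum m x - root_sum m y"
  by (simp add: root_sum_def left_diff_distrib sum_subtractf)

lemma root_sum_add: "root_sum m (\<lambda>j. x j + y j) = root_sum m x + root_sum m y"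
  by (simp add: root_sum_def distrib_right sum.distrib)

lemma root_sum_conjugate:
  assumes "root_sum m d = 0" "m > 0" "coprime k m"
  shows "(\<Sum>j<m. of_int (d (int j)) * uroot m (int k * int j)) = 0"
proof -
  define Q :: "int poly" where "Q = (\<Sum>j<m. Polynomial.monom (d (int j)) j)"
  have Q: "int_eval z Q = (\<Sum>j<m. of_int (d (int j)) * z ^ j)" for z
    by (simp add: Q_def)
  have "uroot m 1 ^ m = 1" using assms by (simp add: uroot_power uroot_self_mult[of m 1, simplified])
  moreover have "int_eval (uroot m 1) Q = 0" using assms(1) by (simp add: Q root_sum_def uroot_power)
  ultimately have "int_eval (uroot m 1 ^ k) Q = 0" using assms by (intro int_eval_coprime_power_eq_0)
  then show ?thesis by (simp add: Q uroot_power mult.commute)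
qed

text \<open>At \<open>h * q + p * g\<close> the root of unity is
  \<open>uroot p h * uroot q g\<close>. Conjugations fixing the q-th roots and moving the p-th roots
  show that the slice values have no nonzero Fourier frequency, so they agree.\<close>

lemma slices_eq:
  assumes p: "prime p" "\<not> p dvd q" and q: "q > 0" and d: "periodic (p * q) d"
    and 0: "root_sum (p * q) d = 0" and h: "h < p" "h' < p"
  shows "root_sum q (\<lambda>g. d (int h * int q + int p * g)) = root_sum q (\<lambda>g. d (int h' * int q + int p * g))"
proof -
  define c where "c = (\<lambda>h. root_sum q (\<lambda>g. d (int h * int q + int p * g)))"
  have p0: "p > 0" using p prime_gt_0_nat by blast
  have cop: "coprime p q" using p by (simp add: prime_imp_coprime)
  have "(\<Sum>h<p. uroot p (int r * int h) * c h) = 0" if r: "r \<in> {1..<p}" for r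
  proof -
    \<comment> \<open>Conjugation by \<open>k\<close> sends p-th roots to their r-th powers and
      fixes q-th roots.\<close>
    obtain k where k: "[k = r] (mod p)" "[k = 1] (mod q)"
      using binary_chinese_remainder_nat[OF cop] by blast
    have "\<not> p dvd r" using r by (auto dest: dvd_imp_le)
    then have "\<not> p dvd k" using k(1) by (simp add: cong_dvd_iff)
    then have "coprime k p" using p(1) by (metis prime_imp_coprime coprime_commute)
    moreover have "coprime k q" using k(2) by (metis cong_imp_coprime cong_sym coprime_1_left)
    ultimately have ck: "coprime k (p * q)" by simp
    have per: "periodic (p * q) (\<lambda>j. of_int (d j) * uroot (p * q) (int k * j))"
    proof -
      have "uroot (p * q) (int k * (j + int (p * q))) = uroot (p * q) (int k * j)" for j
        using p0 q by (intro uroot_cong) (auto simp: cong_iff_dvd_diff algebra_simps)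
      then show ?thesis using d by (simp add: periodic_def)
    qed
    have split: "uroot (p * q) (int k * (int h * int q + int p * int g)) = uroot p (int r * int h) * uroot q (int g)"
      for h g :: nat
    proof -
      have "uroot (p * q) (int k * (int h * int q + int p * int g))
          = uroot (p * q) (int q * (int k * int h)) * uroot (p * q) (int p * (int k * int g))"
        by (simp add: uroot_add[symmetric] algebra_simps)
      also have "\<dots> = uroot p (int k * int h) * uroot q (int k * int g)"
        using p0 q by (simp only: uroot_mult_cancel uroot_mult_cancel')
      also have "uroot p (int k * int h) = uroot p (int r * int h)"
        using p0 k(1) by (intro uroot_cong cong_scalar_right) (simp_all add: cong_int_iff)
      also have "uroot q (int k * int g) = uroot q (1 * int g)"
        using q k(2) cong_int_iff[of k 1 q] by (intro uroot_cong cong_scalar_right) simp_all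
      finally show ?thesis by simp
    qed
    have "0 = (\<Sum>j<p * q. of_int (d (int j)) * uroot (p * q) (int k * int j))"
      using root_sum_conjugate[OF 0 _ ck] p0 q by simp
    also have "\<dots> = (\<Sum>h<p. \<Sum>g<q. of_int (d (int h * int q + int p * int g)) *
        uroot (p * q) (int k * (int h * int q + int p * int g)))"
      by (rule sum_residues_crt[OF cop p0 q per])
    also have "\<dots> = (\<Sum>h<p. uroot p (int r * int h) * c h)"
      unfolding split by (simp add: c_def root_sum_def sum_distrib_left mult_ac)
    finally show ?thesis ..
  qed
  from fourier_constant[of p c, OF p0 this] have "of_nat p * c h = of_nat p * c h'"
    using h by metis
  then show ?thesis using p0 by (simp add: c_def)
qed

text \<open>Here conjugation by \<open>1 + q * r\<close> fixes q-th roots and multiplies the h-th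
  slice by \<open>uroot p (r * h)\<close>. Unlike in \<open>slices_eq\<close>, \<open>r = 0\<close>
  is covered too: all frequencies vanish, hence all slices.\<close>

lemma slices_vanish:
  assumes p: "prime p" "p dvd q" and q: "q > 0"
    and 0: "root_sum (p * q) d = 0" and h: "h < p"
  shows "root_sum q (\<lambda>g. d (int h + int p * g)) = 0"
proof -
  define c where "c = (\<lambda>h. uroot (p * q) (int h) * root_sum q (\<lambda>g. d (int h + int p * g)))"
  have p0: "p > 0" using p prime_gt_0_nat by blast
  have *: "(\<Sum>h<p. uroot p (int r * int h) * c h) = 0" for r
  proof -
    define k where "k = 1 + q * r"
    have "coprime k q" unfolding k_def by (rule coprimeI) (metis dvd_add_left_iff dvd_mult2)
    then have ck: "coprime k (p * q)" using p(2) by (auto elim!: dvdE)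
    have split: "uroot (p * q) (int k * (int h + int p * int g)) =
        uroot (p * q) (int h) * uroot p (int r * int h) * uroot q (int g)"
      for h g :: nat
    proof -
      have "int k * (int h + int p * int g) = 
          int h + int q * (int r * int h) + int p * int g + int (p * q) * (int r * int g)"
        by (simp add: k_def algebra_simps)
      moreover have "uroot (p * q) (int (p * q) * (int r * int g)) = 1"
        using p0 q by (intro uroot_self_mult) simp
      ultimately show ?thesis
        using p0 q by (simp only: uroot_add uroot_mult_cancel uroot_mult_cancel') simp
    qed
    have "0 = (\<Sum>j<p * q. of_int (d (int j)) * uroot (p * q) (int k * int j))"
      using root_sum_conjugate[OF 0 _ ck] p0 q by simp
    also have "\<dots> = (\<Sum>h<p. \<Sum>g<q. of_int (d (int h + int p * int g)) *
        uroot (p * q) (int k * (int h + int p * int g)))"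
      by (rule sum_residues_digits[OF p0])
    also have "\<dots> = (\<Sum>h<p. uroot p (int r * int h) * c h)"
      unfolding split by (simp add: c_def root_sum_def sum_distrib_left mult_ac)
    finally show ?thesis ..
  qed
  have "of_nat p * c h = (\<Sum>h<p. c h)" using fourier_constant[OF p0 * h] .
  also have "\<dots> = 0" using *[of 0] by simp
  finally show ?thesis using p0 by (simp add: c_def uroot_def)
qed

subsection \<open>Two sums with the same value\<close>

definition weight :: "nat \<Rightarrow> (int \<Rightarrow> int) \<Rightarrow> int" where
  "weight m w = (\<Sum>j<m. w (int j))"

definition slice :: "nat \<Rightarrow> nat \<Rightarrow> (int \<Rightarrow> int) \<Rightarrow> nat \<Rightarrow> int \<Rightarrow> int" where
  "slice p q w h g = w (int h * int q + int p * g)"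

lemma periodic_slice: "periodic (p * q) w \<Longrightarrow> periodic q (slice p q w h)"
proof -
  assume w: "periodic (p * q) w"
  have "int h * int q + int p * (g + int q) = int h * int q + int p * g + int (p * q)" for g
    by (simp add: algebra_simps)
  then show ?thesis using w by (simp only: periodic_def slice_def) simp
qed

lemma periodic_add: "periodic m x \<Longrightarrow> periodic m y \<Longrightarrow> periodic m (\<lambda>j. x j + y j)"
  by (simp add: periodic_def)

lemma periodic_diff: "periodic m x \<Longrightarrow> periodic m y \<Longrightarrow> periodic m (\<lambda>j. x j - y j)"
  by (simp add: periodic_def)

lemma weight_nonneg: "(\<And>j. 0 \<le> w j) \<Longrightarrow> 0 \<le> weight m w"
  by (simp add: weight_def sum_nonneg)

lemma weight_add: "weight m (\<lambda>j. x j + y j) = weight m x + weight m y"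
  by (simp add: weight_def sum.distrib)

lemma weight_slices:
  assumes "coprime p q" "p > 0" "q > 0" "periodic (p * q) w"
  shows "weight (p * q) w = (\<Sum>h<p. weight q (slice p q w h))"
  using sum_residues_crt[OF assms] by (simp add: weight_def slice_def)

lemma slice_surj:
  assumes "coprime p q" "p > 0"
  obtains h g where "h < p" "j = int h * int q + int p * g"
proof -
  obtain x where x: "[int q * x = j] (mod int p)"
    using cong_solve_coprime_int[of "int q" "int p"] assms(1)
    by (metis cong_scalar_left coprime_commute coprime_int_iff mult.assoc mult.commute mult_1)
  define h where "h = nat (x mod int p)"
  have h: "int h = x mod int p" using assms(2) by (simp add: h_def)
  have "[int h * int q = j] (mod int p)" using x unfolding h by (simp add: cong_def mod_simps mult.commute)
  then obtain g where "j = int h * int q + int p * g" by (metis cong_iff_lin cong_sym)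
  moreover have "h < p" using assms(2) by (simp add: h_def nat_less_iff)
  ultimately show ?thesis by (rule that[rotated])
qed

lemma periodic_residue:
  assumes "periodic m w" "m > 0"
  obtains i where "i < m" "w j = w (int i)"
proof (rule that)
  show "nat (j mod int m) < m" using assms(2) by (simp add: nat_less_iff)
  show "w j = w (int (nat (j mod int m)))" using assms
    by (intro periodic_cong[OF assms(1)]) (simp add: cong_def)
qed

lemma weight_eq_0_imp:
  assumes "periodic m w" "m > 0" "\<And>j. 0 \<le> w j" "weight m w = 0"
  shows "w j = 0"
proof -
  have "\<forall>i\<in>{..<m}. w (int i) = 0"
    using assms(4) by (simp add: weight_def sum_nonneg_eq_0_iff assms(3))
  then show ?thesis using periodic_residue[OF assms(1,2), of j] by (metis lessThan_iff)
qed

lemma root_sum_zero: "(\<And>j. w j = 0) \<Longrightarrow> root_sum m w = 0"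
  by (simp add: root_sum_def)

lemma root_sum_slices_eq:
  assumes "prime p" "\<not> p dvd q" "q > 0" "periodic (p * q) d"
    and "root_sum (p * q) d = 0" "h < p" "h' < p"
  shows "root_sum q (slice p q d h) = root_sum q (slice p q d h')"
  using slices_eq[OF assms] by (simp add: slice_def[abs_def])

text \<open>Slicing with \<open>q = 1\<close> leaves single coefficients, which must then
  agree.\<close>

lemma root_sum_prime_eq_0_imp:
  assumes "prime p" "periodic p d" "root_sum p d = 0"
  shows "d j = d 0"
proof -
  have p0: "p > 0" using assms(1) by (rule prime_gt_0_nat)
  obtain i where i: "i < p" "d j = d (int i)" using periodic_residue[OF assms(2) p0] .
  have "root_sum 1 (slice p 1 d i) = root_sum 1 (slice p 1 d 0)"
    using assms i p0 by (intro root_sum_slices_eq) (auto simp: not_prime_1 dest: prime_nat_iff[THEN iffD1])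
  then have "d (int i) = d 0" by (simp add: root_sum_def slice_def)
  then show ?thesis using i by simp
qed

lemma root_sum_1_eq_0_imp:
  assumes "periodic 1 d" "root_sum 1 d = 0"
  shows "d j = 0"
proof -
  have "d j = d 0" using periodic_cong[OF assms(1), of j 0] by simp
  also have "d 0 = 0" using assms(2) by (simp add: root_sum_def)
  finally show ?thesis .
qed

text \<open>Serves as a case distinction: \<open>m = 1\<close>, or \<open>m = a\<close> is prime, or
  some prime other than \<open>a\<close> divides \<open>m\<close>.\<close>

lemma squarefree_prime_power:
  fixes m :: nat
  assumes "squarefree m" "m \<noteq> 1" "\<And>p. prime p \<Longrightarrow> p dvd m \<Longrightarrow> p = a"
  shows "m = a \<and> prime a"
proof -
  obtain p where p: "prime p" "p dvd m" using assms(2) prime_factor_nat by blast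
  then have a: "prime a" "a dvd m" using assms(3) by auto
  then obtain k where k: "m = a * k" by blast
  have "k = 1"
  proof (rule ccontr)
    assume "k \<noteq> 1"
    then obtain r where r: "prime r" "r dvd k" using prime_factor_nat by blast
    then have "r = a" using assms(3) k by auto
    then have "a ^ 2 dvd m" using r k by (simp add: power2_eq_square)
    then show False using assms(1) a(1) by (metis squarefree_def not_prime_unit)
  qed
  then show ?thesis using k a by simp
qed

lemma squarefree_prime_split:
  fixes m :: nat
  assumes "squarefree m" "prime p" "p dvd m"
  obtains q where "m = p * q" "\<not> p dvd q" "squarefree q" "coprime p q" "q > 0" "q < m"
proof -
  obtain q where q: "m = p * q" using assms(3) by blast
  have m0: "m \<noteq> 0" using assms(1) by (metis not_squarefree_0)
  have npq: "\<not> p dvd q"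
  proof
    assume "p dvd q"
    then have "p ^ 2 dvd m" using q by (simp add: power2_eq_square)
    then show False using assms(1,2) by (metis squarefree_def not_prime_unit)
  qed
  show ?thesis
    using q npq assms m0 prime_gt_1_nat[OF assms(2)]
    by (intro that[of q]) (auto simp: prime_imp_coprime dest: squarefree_multD)
qed

text \<open>Here \<open>z\<close> of the \<open>p\<close> slices of \<open>x\<close> are zero, the corresponding slices of \<open>y\<close> have weight at least
  \<open>r\<close>, and one slice, of weight \<open>T\<close> in \<open>x\<close>, is heavy in \<open>y\<close>; \<open>c\<close> tells whether it is one of the \<open>z\<close>.\<close>
lemma weight_bound_arith:
  fixes a b p t r z c T W :: int
  assumes "0 \<le> t" "t < a" "a < b" "b \<le> p" "0 \<le> r" "0 \<le> z" "p - t \<le> z" "0 \<le> T"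
    and W1: "z * r \<le> W" and W2: "(z - c) * r + (a - T - r) * (b - 1) \<le> W"
    and "c = 1 \<and> T = 0 \<or> c = 0 \<and> T + (p - z - 1) \<le> t \<and> z \<le> p - 1"
  shows "(a - t) * (b - 1) \<le> W"
proof (cases "r \<le> b - 1")
  case False
  have "(a - t) * (b - 1) \<le> z * r" using assms False by (intro mult_mono) auto
  then show ?thesis using W1 by simp
next
  case r: True
  show ?thesis
  proof (cases "c = 1")
    case True
    then have "T = 0" using assms by auto
    \<comment> \<open>The bound \<open>W2\<close> is at least a(b-1) + r(p-t-b); here p >= b, and t
      r is at most t(b-1).\<close>
    have "(p - t) * r \<le> z * r" using assms by (intro mult_right_mono) auto
    moreover have "b * r \<le> p * r" using assms by (intro mult_right_mono) auto
    moreover have "t * r \<le> t * (b - 1)" using assms r by (intro mult_left_mono) auto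
    ultimately show ?thesis using W2 True \<open>T = 0\<close> by (simp add: algebra_simps)
  next
    case False
    then have c: "c = 0" "T \<le> t - (p - z - 1)" "z \<le> p - 1" using assms by auto
    \<comment> \<open>Each of the \<open>p - z - 1\<close> other nonzero slices of \<open>x\<close>
      lowers \<open>T\<close> by one, a gain of \<open>b - 1 \<ge> r\<close>, which tops
      \<open>z * r\<close> up to (p-1) r.\<close>
    have "(a - (t - (p - z - 1)) - r) * (b - 1) \<le> (a - T - r) * (b - 1)"
      using c assms by (intro mult_right_mono) auto
    moreover have "(p - z - 1) * r \<le> (p - z - 1) * (b - 1)" using c r by (intro mult_left_mono) auto
    moreover have "b * r \<le> p * r" using assms by (intro mult_right_mono) auto
    ultimately show ?thesis using W2 c(1) by (simp add: algebra_simps)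
  qed
qed

text \<open>The bound is the natural one: for primes \<open>a\<close> and \<open>b\<close>, a sum of
  t of the a-th roots of unity is minus the sum of the other a - t, and each minus sign can be
  replaced by the b - 1 nontrivial b-th roots. The induction splits off a prime
  \<open>p \<ge> b\<close>, which leaves only \<open>m = 1\<close> and \<open>m = a\<close> as base
  cases.\<close>

lemma root_sum_eq_imp_le_or_heavy:
  fixes a b m :: nat
  assumes "squarefree m" "a < b" "\<And>p. prime p \<Longrightarrow> p dvd m \<Longrightarrow> p = a \<or> b \<le> p"
    and "periodic m x" "periodic m y" "\<And>j. 0 \<le> x j" "\<And>j. 0 \<le> y j"
    and "root_sum m x = root_sum m y"
  shows "(\<forall>j. x j \<le> y j) \<or> (int a - weight m x) * (int b - 1) \<le> weight m y"
  using assms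
proof (induction m arbitrary: x y rule: less_induct)
  case (less m)
  note sqf = less.prems(1) and ab = less.prems(2) and pr = less.prems(3)
    and px = less.prems(4) and py = less.prems(5) and x0 = less.prems(6) and y0 = less.prems(7)
    and eq = less.prems(8)
  have pd: "periodic m (\<lambda>j. y j - x j)" using px py by (rule periodic_diff[rotated])
  have d0: "root_sum m (\<lambda>j. y j - x j) = 0" using eq by (simp add: root_sum_diff)
  consider "m = 1" | "m = a" "prime a" | p where "prime p" "p dvd m" "b \<le> p"
    using squarefree_prime_power[OF sqf] pr by metis
  then show ?case
  proof cases
    case 1
    then have "y j - x j = 0" for j using root_sum_1_eq_0_imp pd d0 by metis
    then show ?thesis by simp
  next
    case 2
    then have d: "y j - x j = y 0 - x 0" for j using root_sum_prime_eq_0_imp pd d0 by metis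
    show ?thesis
    proof (cases "y 0 - x 0 \<ge> 0")
      case True
      then show ?thesis using d by (metis diff_ge_0_iff_ge)
    next
      case False
      \<comment> \<open>The constant difference is negative, so \<open>x\<close> is positive at all
        \<open>a\<close> residues and the first factor of the bound is at most 0.\<close>
      then have "1 \<le> x j" for j using d[of j] y0[of j] by linarith
      then have "(\<Sum>j<m. 1) \<le> weight m x" unfolding weight_def by (intro sum_mono) auto
      then have "(int a - weight m x) * (int b - 1) \<le> 0"
        using 2 ab by (intro mult_nonpos_nonneg) auto
      then show ?thesis using weight_nonneg[of y m, OF y0] by linarith
    qed
  next
    case 3
    obtain q where q: "m = p * q" "\<not> p dvd q" "squarefree q" "coprime p q" "q > 0" "q < m"
      using squarefree_prime_split[OF sqf 3(1,2)] .
    have p0: "p > 0" using 3 prime_gt_0_nat by blast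
    define X where "X = slice p q x"
    define Y where "Y = slice p q y"
    define tx where "tx h = weight q (X h)" for h
    define ty where "ty h = weight q (Y h)" for h
    have pX: "periodic q (X h)" and pY: "periodic q (Y h)" for h
      using px py periodic_slice q(1) by (auto simp: X_def Y_def)
    have X0: "0 \<le> X h g" and Y0: "0 \<le> Y h g" for h g
      using x0 y0 by (auto simp: X_def Y_def slice_def)
    have tx0: "0 \<le> tx h" and ty0: "0 \<le> ty h" for h
      using X0 Y0 by (auto simp: tx_def ty_def intro: weight_nonneg)
    have wx: "weight m x = (\<Sum>h<p. tx h)" and wy: "weight m y = (\<Sum>h<p. ty h)"
      using px py q p0 by (auto simp: tx_def ty_def X_def Y_def weight_slices)
    have slice_eq: "root_sum q (Y h) - root_sum q (X h) = root_sum q (Y h') - root_sum q (X h')"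
      if "h < p" "h' < p" for h h'
      using root_sum_slices_eq[OF 3(1) q(2,5) _ _ that, of "\<lambda>j. y j - x j"] pd d0 q(1)
      by (simp add: X_def Y_def slice_def[abs_def] root_sum_diff)
    define t where "t = weight m x"
    have t0: "0 \<le> t" using x0 by (simp add: t_def weight_nonneg)
    show ?thesis
    proof (rule disjCI)
      assume light: "\<not> (int a - weight m x) * (int b - 1) \<le> weight m y"
      have ta: "t < int a"
      proof (rule ccontr)
        assume "\<not> t < int a"
        then have "(int a - t) * (int b - 1) \<le> 0" using ab by (intro mult_nonpos_nonneg) auto
        then show False using light weight_nonneg[of y m] y0 by (simp add: t_def)
      qed
      \<comment> \<open>Where \<open>X h0\<close> is zero, \<open>Y h0\<close> carries the common difference of all slices, so induction
        applies to \<open>X h + Y h0\<close> and \<open>Y h\<close>.\<close>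
      define Z where "Z = {h. h < p \<and> tx h = 0}"
      have Z: "Z \<subseteq> {..<p}" "finite Z" by (auto simp: Z_def)
      \<comment> \<open>Each slice outside \<open>Z\<close> takes at least one unit of the weight
        \<open>t\<close>; the slice \<open>h\<close> takes \<open>tx h\<close>.\<close>
      have supp: "int p - int (card Z) \<le> t - (tx h - 1)" if "h < p" "h \<notin> Z" for h
      proof -
        have "t = (\<Sum>h\<in>{..<p} - Z. tx h)"
          unfolding t_def wx using Z by (intro sum.mono_neutral_right) (auto simp: Z_def)
        also have "\<dots> = tx h + (\<Sum>h\<in>{..<p} - Z - {h}. tx h)" using that by (subst sum.remove[of _ h]) auto
        finally have "t = tx h + (\<Sum>h\<in>{..<p} - Z - {h}. tx h)" .
        moreover have "(\<Sum>h\<in>{..<p} - Z - {h}. 1) \<le> (\<Sum>h\<in>{..<p} - Z - {h}. tx h)"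
        proof (intro sum_mono)
          fix i assume "i \<in> {..<p} - Z - {h}"
          then have "tx i \<noteq> 0" by (auto simp: Z_def)
          then show "1 \<le> tx i" using tx0[of i] by linarith
        qed
        moreover have "int (card ({..<p} - Z - {h})) = int p - int (card Z) - 1"
        proof -
          have "card (insert h Z) \<le> card {..<p}" using Z that by (intro card_mono) auto
          then show ?thesis using Z that by (simp add: card_Diff_subset of_nat_diff)
        qed
        ultimately show ?thesis by simp
      qed
      have cardZ: "int p - t \<le> int (card Z)"
      proof (cases "Z = {..<p}")
        case False
        then obtain h where h: "h < p" "h \<notin> Z" using Z by auto
        then have "tx h \<noteq> 0" by (auto simp: Z_def)
        then show ?thesis using supp[OF h] tx0[of h] by linarith
      qed (use t0 in simp)
      have "int (card Z) > 0" using cardZ ta ab 3(3) by linarith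
      \<comment> \<open>Minimality gives every slice of \<open>y\<close> over \<open>Z\<close> at
        least the weight \<open>ty h0\<close>; this is \<open>r\<close> in
        \<open>weight_bound_arith\<close>.\<close>
      then obtain h0 where h0: "h0 \<in> Z" "\<And>h. h \<in> Z \<Longrightarrow> ty h0 \<le> ty h"
        using ex_has_least_nat[of "\<lambda>h. h \<in> Z" _ "\<lambda>h. nat (ty h)"] ty0
        by (metis card_gt_0_iff ex_in_conv nat_le_eq_zle of_nat_0_less_iff)
      have h0p: "h0 < p" and Xh0: "X h0 g = 0" for g
        using h0 weight_eq_0_imp[OF pX q(5) X0] by (auto simp: Z_def tx_def)
      have IH: "(\<forall>g. X h g + Y h0 g \<le> Y h g) \<or> (int a - (tx h + ty h0)) * (int b - 1) \<le> ty h"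
        if "h < p" for h
      proof -
        have "root_sum q (\<lambda>g. X h g + Y h0 g) = root_sum q (Y h)"
          using slice_eq[OF that h0p] root_sum_zero[of "X h0" q] Xh0 by (simp add: root_sum_add diff_eq_eq add.commute)
        then show ?thesis
          using less.IH[OF q(6,3) ab, of "\<lambda>g. X h g + Y h0 g" "Y h"] pr q(1) pX pY X0 Y0
          by (simp add: periodic_add weight_add tx_def ty_def)
      qed
      show "\<forall>j. x j \<le> y j"
      proof (cases "\<forall>h<p. \<forall>g. X h g + Y h0 g \<le> Y h g")
        case True
        show ?thesis
        proof
          fix j
          obtain h g where hg: "h < p" "j = int h * int q + int p * g" using slice_surj[OF q(4) p0] .
          then have "X h g \<le> Y h g" using True Y0[of h0 g] by (metis add.commute add_increasing order.trans order_refl)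
          then show "x j \<le> y j" using hg by (simp add: X_def Y_def slice_def)
        qed
      next
        case False
        then obtain h1 where h1: "h1 < p" "(int a - (tx h1 + ty h0)) * (int b - 1) \<le> ty h1"
          using IH by blast
        have W: "(\<Sum>h\<in>A. ty h) \<le> weight m y" if "A \<subseteq> {..<p}" for A
          unfolding wy using that ty0 by (intro sum_mono2) auto
        have W1: "int (card A) * ty h0 \<le> (\<Sum>h\<in>A. ty h)" if "A \<subseteq> Z" for A
          using sum_mono[of A "\<lambda>_. ty h0" ty] h0(2) that by auto
        define c :: int where "c = (if h1 \<in> Z then 1 else 0)"
        have "int (card (Z - {h1})) = int (card Z) - c"
          using card.remove[of Z h1] Z by (auto simp: c_def)
        then have "(int (card Z) - c) * ty h0 + ty h1 \<le> (\<Sum>h\<in>Z - {h1}. ty h) + ty h1"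
          using W1[of "Z - {h1}"] by auto
        also have "\<dots> = (\<Sum>h\<in>insert h1 Z. ty h)" using Z by (simp add: sum.insert_remove)
        also have "\<dots> \<le> weight m y" using h1 Z by (intro W) auto
        finally have W2: "(int (card Z) - c) * ty h0 + (int a - tx h1 - ty h0) * (int b - 1) \<le> weight m y"
          using h1(2) by (simp add: diff_diff_eq)
        have "(int a - t) * (int b - 1) \<le> weight m y"
        proof (rule weight_bound_arith[OF t0 ta _ _ ty0 _ cardZ tx0 _ W2])
          show "int (card Z) * ty h0 \<le> weight m y" using W1[of Z] W[of Z] Z by simp
          show "c = 1 \<and> tx h1 = 0 \<or> c = 0 \<and> tx h1 + (int p - int (card Z) - 1) \<le> t \<and> int (card Z) \<le> int p - 1"
          proof (cases "h1 \<in> Z")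
            case False
            then have "card Z < card {..<p}" using h1 Z by (intro psubset_card_mono) auto
            then show ?thesis using supp[OF h1(1) False] False by (simp add: c_def)
          qed (simp add: c_def Z_def)
        qed (use ab 3 in auto)
        then show ?thesis using light by (simp add: t_def)
      qed
    qed
  qed
qed

subsection \<open>Cosets in short vanishing sums\<close>

text \<open>\<open>m div r\<close> generates the subgroup of order \<open>r\<close> in Z_m when
  \<open>r\<close> divides \<open>m\<close>.\<close>

definition contains_coset :: "nat \<Rightarrow> (int \<Rightarrow> int) \<Rightarrow> nat \<Rightarrow> int \<Rightarrow> bool" where
  "contains_coset m w r g \<longleftrightarrow> (\<forall>k. 1 \<le> w (g + k * int (m div r)))"

lemma contains_coset_lift:
  assumes "r dvd q" "contains_coset q (\<lambda>g. w (c + int p * g)) r g"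
  shows "contains_coset (p * q) w r (c + int p * g)"
proof -
  have "int (p * q div r) = int p * int (q div r)"
    using assms(1) by (metis div_mult_swap of_nat_mult)
  then have "c + int p * g + k * int (p * q div r) = c + int p * (g + k * int (q div r))" for k
    by (simp add: algebra_simps)
  then show ?thesis using assms(2) unfolding contains_coset_def by metis
qed

text \<open>For \<open>t < a\<close> the second bound is at least a(b-1) + 2t, and a(b-1) + 2 >= 3a
  + b amounts to (a-1)(b-4) >= 2. Equality holds at a = 3, b = 5, p = 7, t = 1.\<close>

lemma heavy_slices_arith:
  fixes a b p t W :: int
  assumes "3 \<le> a" "a + 2 \<le> b" "b + 2 \<le> p" "1 \<le> t"
    and 1: "p * t \<le> W" and 2: "(p - 1) * t + (a - t) * (b - 1) \<le> W"
  shows "3 * a + b \<le> W"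
proof (cases "a \<le> t")
  case True
  have "(b + 2) * a \<le> p * t" using assms True by (intro mult_mono) auto
  moreover have "3 * b \<le> a * b" using assms by (intro mult_right_mono) auto
  moreover have "(b + 2) * a = a * b + 2 * a" by (simp add: algebra_simps)
  ultimately show ?thesis using 1 assms(1,2) by linarith
next
  case False
  have "(b + 1) * t \<le> (p - 1) * t" using assms by (intro mult_right_mono) auto
  moreover have "2 * 1 \<le> (a - 1) * (b - 4)" using assms by (intro mult_mono) auto
  ultimately show ?thesis using 2 assms by (simp add: algebra_simps)
qed

text \<open>A repeated prime gives vanishing slices and a direct induction. For squarefree
  \<open>m\<close> the lightest slice decides: if it is empty, all slices vanish; if it lies below
  all others, its support yields cosets of order \<open>p\<close>; otherwise the comparison of two
  sums makes \<open>w\<close> too heavy.\<close>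

theorem light_vanishing_sum_contains_coset:
  fixes a b m :: nat
  assumes "m > 0" "odd m" "3 \<le> a" "a + 2 \<le> b" "\<And>p. prime p \<Longrightarrow> p dvd m \<Longrightarrow> p = a \<or> b \<le> p"
    and "periodic m w" "\<And>j. 0 \<le> w j" "root_sum m w = 0"
    and "0 < weight m w" "weight m w < 3 * int a + int b"
  shows "\<exists>r g. prime r \<and> r dvd m \<and> contains_coset m w r g"
  using assms
proof (induction m arbitrary: w rule: less_induct)
  case (less m)
  note ab = less.prems(3,4) and pr = less.prems(5) and pw = less.prems(6) and w0 = less.prems(7)
    and rs = less.prems(8) and light = less.prems(9,10)
  show ?case
  proof (cases "squarefree m")
    case False
    then obtain p where p: "prime p" "p ^ 2 dvd m"
      using squarefree_factorial_semiring[of m] less.prems(1) by blast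
    then obtain q' where "m = p ^ 2 * q'" by blast
    define q where "q = p * q'"
    have q: "m = p * q" "p dvd q" using \<open>m = p ^ 2 * q'\<close> by (auto simp: q_def power2_eq_square)
    have q0: "q > 0" "odd q" "q < m" and p0: "p > 0"
      using q less.prems(1,2) prime_gt_1_nat[OF p(1)] by auto
    define W where "W h g = w (int h + int p * g)" for h :: nat and g
    have W0: "0 \<le> W h g" for h g using w0 by (simp add: W_def)
    have pW: "periodic q (W h)" for h
    proof -
      have "int h + int p * (g + int q) = int h + int p * g + int (p * q)" for g
        by (simp add: algebra_simps)
      then show ?thesis using pw q(1) by (simp only: periodic_def W_def) simp
    qed
    have wt: "weight m w = (\<Sum>h<p. weight q (W h))"
      unfolding q(1) weight_def W_def by (rule sum_residues_digits[OF p0])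
    have "\<not> (\<forall>h<p. weight q (W h) = 0)" using light(1) wt by (intro notI) simp
    then obtain h where h: "h < p" "weight q (W h) \<noteq> 0" by blast
    have le: "weight q (W h) \<le> weight m w"
      unfolding wt using h W0 by (intro member_le_sum) (auto intro: weight_nonneg)
    have pos: "0 < weight q (W h)" using h(2) weight_nonneg[of "W h" q, OF W0] by linarith
    have rs': "root_sum q (W h) = 0"
      using slices_vanish[OF p(1) q(2) q0(1) _ h(1), of w] rs q(1) by (simp add: W_def[abs_def])
    have pr': "r = a \<or> b \<le> r" if "prime r" "r dvd q" for r
      using pr[of r] that q(1) by simp
    obtain r g where "prime r" "r dvd q" "contains_coset q (W h) r g"
      using less.IH[OF q0(3,1,2) ab pr' pW W0 rs' pos le_less_trans[OF le light(2)]] by blast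
    then show ?thesis
      using contains_coset_lift[of r q w "int h" p g] q(1) by (auto simp: W_def[abs_def])
  next
    case sqf: True
    have "m \<noteq> 1"
    proof
      assume m: "m = 1"
      then have "w 0 = 0" using root_sum_1_eq_0_imp pw rs by metis
      then show False using light(1) m by (simp add: weight_def)
    qed
    \<comment> \<open>The largest prime is taken so that a further prime \<open>r \<ge> b\<close> of
      \<open>q\<close> forces \<open>p \<ge> b + 2\<close>.\<close>
    define p where "p = Max (prime_factors m)"
    have "prime_factors m \<noteq> {}" using \<open>m \<noteq> 1\<close> less.prems(1) by (simp add: prime_factorization_empty_iff)
    then have pin: "p \<in> prime_factors m" unfolding p_def by (intro Max_in) auto
    then have p: "prime p" "p dvd m" by auto
    have pmax: "r \<le> p" if "prime r" "r dvd m" for r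
      unfolding p_def using that less.prems(1) by (intro Max_ge) (auto simp: in_prime_factors_iff)
    obtain q where q: "m = p * q" "\<not> p dvd q" "squarefree q" "coprime p q" "q > 0" "q < m"
      using squarefree_prime_split[OF sqf p] .
    have p0: "p > 0" using p prime_gt_0_nat by blast
    have pr': "r = a \<or> b \<le> r" if "prime r" "r dvd q" for r
      using pr[of r] that q(1) by simp
    define W where "W = slice p q w"
    define t where "t h = weight q (W h)" for h
    have W0: "0 \<le> W h g" for h g using w0 by (simp add: W_def slice_def)
    have t0: "0 \<le> t h" for h using W0 by (auto simp: t_def intro: weight_nonneg)
    have pW: "periodic q (W h)" for h using pw periodic_slice q(1) by (auto simp: W_def)
    have wt: "weight m w = (\<Sum>h<p. t h)"
      using pw q p0 by (auto simp: t_def W_def weight_slices)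
    have eq: "root_sum q (W h) = root_sum q (W h')" if "h < p" "h' < p" for h h'
      using root_sum_slices_eq[OF p(1) q(2,5) _ _ that, of w] pw rs q(1) by (simp add: W_def)
    obtain h0 where h0: "h0 < p" "\<And>h. h < p \<Longrightarrow> t h0 \<le> t h"
      using ex_has_least_nat[of "\<lambda>h. h < p" 0 "\<lambda>h. nat (t h)"] p0 t0 by (metis nat_le_eq_zle)
    show ?thesis
    proof (cases "t h0 = 0")
      case True
      then have "W h0 g = 0" for g using weight_eq_0_imp[OF pW q(5) W0] by (simp add: t_def)
      then have "root_sum q (W h0) = 0" by (rule root_sum_zero)
      have "\<not> (\<forall>h<p. t h = 0)" using light(1) wt by (intro notI) simp
      then obtain h where h: "h < p" "t h \<noteq> 0" by blast
      then have rh: "root_sum q (W h) = 0" using eq h0(1) \<open>root_sum q (W h0) = 0\<close> by metis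
      have le: "weight q (W h) \<le> weight m w" unfolding t_def[symmetric] wt using h t0 by (intro member_le_sum) auto
      have pos: "0 < weight q (W h)" using h(2) t0[of h] by (simp add: t_def)
      have "odd q" using less.prems(2) q(1) by simp
      obtain r g where "prime r" "r dvd q" "contains_coset q (W h) r g"
        using less.IH[OF q(6,5) \<open>odd q\<close> ab pr' pW W0 rh pos le_less_trans[OF le light(2)]] by blast
      then show ?thesis
        using contains_coset_lift[of r q w "int h * int q" p g] q(1)
        by (auto simp: W_def slice_def[abs_def])
    next
      case False
      then have t1: "1 \<le> t h0" using t0[of h0] by linarith
      show ?thesis
      proof (cases "\<forall>h<p. \<forall>g. W h0 g \<le> W h g")
        case True
        obtain g where g: "W h0 (int g) \<noteq> 0"
          using False unfolding t_def weight_def by (meson sum.neutral)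
        have "1 \<le> w (int p * int g + k * int q)" for k
        proof -
          define h where "h = nat (k mod int p)"
          have h: "h < p" "int h = k mod int p" using p0 by (auto simp: h_def nat_less_iff)
          have "1 \<le> W h0 (int g)" using g W0[of h0 "int g"] by linarith
          also have "\<dots> \<le> W h (int g)" using True h by blast
          also have "\<dots> = w (int p * int g + k * int q)"
            unfolding W_def slice_def
          proof (rule periodic_cong[OF pw])
            have "[int h * int q = k * int q] (mod (int p * int q))"
              unfolding h(2) by (metis cong_def mod_mod_trivial mod_mult_mult2)
            then show "[int h * int q + int p * int g = int p * int g + k * int q] (mod int m)"
              unfolding q(1) by (simp add: cong_iff_dvd_diff algebra_simps)
          qed
          finally show ?thesis .
        qed
        then have "contains_coset m w p (int p * int g)"
          using p0 by (simp add: contains_coset_def q(1))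
        then show ?thesis using p by blast
      next
        case nle: False
        then obtain h1 where h1: "h1 < p" "\<not> (\<forall>g. W h0 g \<le> W h1 g)" by blast
        have dv: "root_sum q (\<lambda>g. W h1 g - W h0 g) = 0" using eq[OF h1(1) h0(1)] by (simp add: root_sum_diff)
        have pd: "periodic q (\<lambda>g. W h1 g - W h0 g)" using pW by (intro periodic_diff)
        have "q \<noteq> 1"
        proof
          assume "q = 1"
          then have "W h1 g - W h0 g = 0" for g using root_sum_1_eq_0_imp pd dv by metis
          then show False using h1 by simp
        qed
        \<comment> \<open>This excludes \<open>q = a\<close>: for prime \<open>q\<close> the two
          slices differ by a constant, and \<open>h0\<close> would not be lightest.\<close>
        have "\<not> prime q"
        proof
          assume "prime q"
          then have d: "W h1 g - W h0 g = W h1 0 - W h0 0" for g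
            using root_sum_prime_eq_0_imp[OF _ pd dv] by blast
          then have "W h1 0 - W h0 0 < 0" using h1(2) by (metis diff_ge_0_iff_ge not_less)
          then have "W h1 g < W h0 g" for g using d[of g] by linarith
          then have "t h1 < t h0" unfolding t_def weight_def using q(5) by (intro sum_strict_mono) auto
          then show False using h0(2)[OF h1(1)] by simp
        qed
        then obtain r where r: "prime r" "r dvd q" "r \<noteq> a"
          using squarefree_prime_power[OF q(3) \<open>q \<noteq> 1\<close>, of a] by blast
        have "r dvd m" using r(2) q(1) by simp
        then have "b \<le> r" "r \<le> p" "odd r" "odd p"
          using r pr[of r] pmax[of r] p(2) less.prems(2) by (blast dest: dvd_trans)+
        moreover have "r \<noteq> p" using r(2) q(2) by blast
        ultimately have bp: "b + 2 \<le> p" by presburger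
        have "(int a - t h0) * (int b - 1) \<le> t h1"
          using root_sum_eq_imp_le_or_heavy[OF q(3) _ pr' pW pW W0 W0 eq[OF h0(1) h1(1)]]
            ab h1(2) by (simp add: t_def)
        moreover have "(int p - 1) * t h0 \<le> (\<Sum>h\<in>{..<p} - {h1}. t h)"
          using sum_mono[of "{..<p} - {h1}" "\<lambda>_. t h0" t] h0(2) h1(1) p0 by (simp add: of_nat_diff Suc_le_eq)
        moreover have "weight m w = t h1 + (\<Sum>h\<in>{..<p} - {h1}. t h)"
          unfolding wt using h1(1) by (intro sum.remove) auto
        ultimately have "(int p - 1) * t h0 + (int a - t h0) * (int b - 1) \<le> weight m w" by linarith
        moreover have "int p * t h0 \<le> weight m w"
          unfolding wt using sum_mono[of "{..<p}" "\<lambda>_. t h0" t] h0(2) by simp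
        ultimately have "3 * int a + int b \<le> weight m w"
          using ab bp t1 by (intro heavy_slices_arith[of _ _ "int p" "t h0"]) auto
        then show ?thesis using light(2) by simp
      qed
    qed
  qed
qed

section \<open>Removing cosets from a short vanishing sum\<close>

definition coset_indicator :: "nat \<Rightarrow> nat \<Rightarrow> int \<Rightarrow> int \<Rightarrow> int" where
  "coset_indicator m r g j = (if int (m div r) dvd j - g then 1 else 0)"

lemma periodic_coset_indicator: "r dvd m \<Longrightarrow> periodic m (coset_indicator m r g)"
proof -
  assume "r dvd m"
  then have "int (m div r) dvd int m" by (metis dvd_div_mult_self dvd_triv_left int_dvd_int_iff)
  then have "int (m div r) dvd j + int m - g \<longleftrightarrow> int (m div r) dvd j - g" for j
    using dvd_add_left_iff[of "int (m div r)" "int m" "j - g"] by (simp add: algebra_simps)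
  then show ?thesis by (simp add: periodic_def coset_indicator_def)
qed

text \<open>Constant \<open>F\<close> gives the weight of a coset, \<open>F = uroot m\<close> its
  value.\<close>

lemma sum_coset_indicator:
  fixes F :: "int \<Rightarrow> 'a :: comm_ring_1"
  assumes "m > 0" "r dvd m" "periodic m F"
  shows "(\<Sum>j<m. of_int (coset_indicator m r g (int j)) * F (int j)) = (\<Sum>k<r. F (g + int k * int (m div r)))"
proof -
  define R where "R = m div r"
  have m: "m = R * r" and R: "R > 0" and r: "r > 0" using assms(1,2) by (auto simp: R_def)
  define h where "h = nat (g mod int R)"
  have h: "int h = g mod int R" "h < R" using R by (auto simp: h_def nat_less_iff)
  have ind: "coset_indicator m r g (int i + int R * int k) = (if i = h then 1 else 0)" if "i < R" for i k :: nat
  proof -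
    have "int i + int R * int k - g = (int i - g) + int R * int k" by simp
    then have "int R dvd int i + int R * int k - g \<longleftrightarrow> int R dvd int i - g"
      by (simp only: dvd_add_left_iff[OF dvd_triv_left])
    also have "\<dots> \<longleftrightarrow> [int i = g] (mod int R)" by (simp only: cong_iff_dvd_diff)
    also have "\<dots> \<longleftrightarrow> i = h" using h that by (auto simp: cong_def)
    finally show ?thesis by (simp add: coset_indicator_def R_def)
  qed
  have "(\<Sum>j<m. of_int (coset_indicator m r g (int j)) * F (int j)) =
      (\<Sum>i<R. \<Sum>k<r. of_int (coset_indicator m r g (int i + int R * int k)) * F (int i + int R * int k))"
    unfolding m by (rule sum_residues_digits[OF R, of "\<lambda>j. of_int (coset_indicator (R * r) r g j) * F j"])
  also have "\<dots> = (\<Sum>i<R. if i = h then (\<Sum>k<r. F (int h + int R * int k)) else 0)"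
    by (intro sum.cong) (auto simp: ind)
  also have "\<dots> = (\<Sum>k<r. F (int h + int R * int k))" using h by simp
  also have "\<dots> = (\<Sum>k<r. F (g + int k * int R))"
  proof -
    \<comment> \<open>The reduced representative \<open>h\<close> is \<open>c\<close> steps of
      length \<open>R\<close> away from \<open>g\<close>; a sum over a full period of
      \<open>G\<close> is unchanged by this shift.\<close>
    define c where "c = (int h - g) div int R"
    have "int R dvd int h - g" unfolding h(1) by (simp flip: mod_eq_dvd_iff)
    then have c: "int h = g + int R * c" by (simp add: c_def)
    define G where "G k = F (g + k * int R)" for k
    have pG: "periodic r G"
    proof -
      have "g + (k + int r) * int R = g + k * int R + int m" for k by (simp add: m algebra_simps)
      then show ?thesis using assms(3) by (simp only: periodic_def G_def) simp
    qed
    have "(\<Sum>k<r. G (int k + c)) = (\<Sum>k<r. G (int k))"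
    proof (rule sum.reindex_bij_witness[of _ "\<lambda>k. nat ((int k - c) mod int r)" "\<lambda>k. nat ((int k + c) mod int r)"])
      show "G (int (nat ((int k + c) mod int r))) = G (int k + c)" for k
        using r by (intro periodic_cong[OF pG]) (simp add: cong_def)
    qed (use r in \<open>auto simp: nat_less_iff mod_diff_left_eq mod_add_left_eq\<close>)
    moreover have "F (int h + int R * int k) = G (int k + c)" for k
      unfolding G_def c by (simp add: algebra_simps)
    ultimately show ?thesis by (simp add: G_def)
  qed
  finally show ?thesis by (simp add: R_def)
qed

lemma weight_coset_indicator:
  assumes "m > 0" "r dvd m"
  shows "weight m (coset_indicator m r g) = int r"
  using sum_coset_indicator[OF assms, of "\<lambda>_. 1 :: int" g] by (simp add: weight_def periodic_def)

lemma root_sum_coset_indicator: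
  assumes "m > 0" "r dvd m" "r > 1"
  shows "root_sum m (coset_indicator m r g) = 0"
proof -
  have m: "m = (m div r) * r" using assms by simp
  have R: "m div r > 0" using assms by auto
  have "root_sum m (coset_indicator m r g) = (\<Sum>k<r. uroot m (g + int k * int (m div r)))"
    unfolding root_sum_def by (rule sum_coset_indicator[OF assms(1,2) periodic_uroot[OF assms(1)]])
  also have "\<dots> = uroot m g * (\<Sum>k<r. uroot r (int k * 1))"
  proof -
    have "uroot m (int k * int (m div r)) = uroot r (int k)" for k
      using uroot_mult_cancel[OF R, of r "int k"] m by (simp add: mult.commute)
    then show ?thesis by (simp add: uroot_add sum_distrib_left)
  qed
  also have "\<dots> = 0" using assms(3) sum_uroot[of r 1] by simp
  finally show ?thesis .
qed

text \<open>Cosets are removed greedily: the rest is nonnegative, vanishing and lighter, so the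
  bound persists. The total of the orders is recorded for the arithmetic on
  \<open>2 ^ n\<close>.\<close>

lemma light_vanishing_sum_decomposition:
  fixes a b m :: nat
  assumes m: "m > 0" "odd m" "3 \<le> a" "a + 2 \<le> b" "\<And>p. prime p \<Longrightarrow> p dvd m \<Longrightarrow> p = a \<or> b \<le> p"
    and "periodic m w" "\<And>j. 0 \<le> w j" "root_sum m w = 0" "weight m w < 3 * int a + int b"
  shows "\<exists>L. (\<forall>(r, g)\<in>set L. prime r \<and> r dvd m) \<and> (\<forall>j. w j = (\<Sum>(r, g)\<leftarrow>L. coset_indicator m r g j))
     \<and> weight m w = int (\<Sum>(r, g)\<leftarrow>L. r)"
  using assms(6-)
proof (induction "nat (weight m w)" arbitrary: w rule: less_induct)
  case less
  show ?case
  proof (cases "weight m w = 0")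
    case True
    then have "w j = 0" for j using weight_eq_0_imp less.prems m(1) by blast
    then show ?thesis using True by (intro exI[of _ "[]"]) simp
  next
    case False
    then have pos: "0 < weight m w" using weight_nonneg[of w m, OF less.prems(2)] by linarith
    obtain r g where rg: "prime r" "r dvd m" "contains_coset m w r g"
      using light_vanishing_sum_contains_coset[OF m less.prems(1-3) pos less.prems(4)] by blast
    define v where "v = (\<lambda>j. w j - coset_indicator m r g j)"
    have w: "w = (\<lambda>j. v j + coset_indicator m r g j)" by (simp add: v_def)
    have wt: "weight m w = weight m v + int r"
      unfolding w weight_add using weight_coset_indicator[OF m(1) rg(2)] by simp
    have pv: "periodic m v" unfolding v_def
      using less.prems(1) periodic_coset_indicator[OF rg(2)] by (rule periodic_diff)
    have v0: "0 \<le> v j" for j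
    proof (cases "int (m div r) dvd j - g")
      case True
      then obtain k where "j - g = int (m div r) * k" ..
      then have "j = g + k * int (m div r)" by (simp add: algebra_simps)
      then have "1 \<le> w j" using rg(3) by (simp add: contains_coset_def)
      then show ?thesis by (simp add: v_def coset_indicator_def)
    next
      case False
      then show ?thesis using less.prems(2) by (simp add: v_def coset_indicator_def)
    qed
    have rv: "root_sum m v = 0"
      unfolding v_def root_sum_diff using less.prems(3) root_sum_coset_indicator[OF m(1) rg(2)] prime_gt_1_nat[OF rg(1)] by simp
    have r0: "0 < int r" using prime_gt_0_nat[OF rg(1)] by simp
    have "0 \<le> weight m v" using v0 by (rule weight_nonneg)
    then have "nat (weight m v) < nat (weight m w)" "weight m v < 3 * int a + int b"
      using wt r0 less.prems(4) by auto
    from less.hyps[OF this(1) pv v0 rv this(2)] obtain L where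
      "\<forall>(r, g)\<in>set L. prime r \<and> r dvd m" "\<forall>j. v j = (\<Sum>(r, g)\<leftarrow>L. coset_indicator m r g j)"
      "weight m v = int (\<Sum>(r, g)\<leftarrow>L. r)" by blast
    then show ?thesis using rg(1,2) wt w by (intro exI[of _ "(r, g) # L"]) auto
  qed
qed

lemma sum_list_ge_with_large:
  fixes a b :: nat
  assumes "\<And>r. r \<in> set L \<Longrightarrow> a \<le> r" "x \<in> set L" "b \<le> x"
  shows "(length L - 1) * a + b \<le> sum_list L"
proof -
  have "length xs * a \<le> sum_list xs" if "\<And>r. r \<in> set xs \<Longrightarrow> a \<le> r" for xs
    using that by (induction xs) (auto intro: add_mono)
  moreover have "a \<le> r" if "r \<in> set (remove1 x L)" for r
    using assms(1) that set_remove1_subset by fast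
  ultimately have "(length L - 1) * a \<le> sum_list (remove1 x L)"
    using assms(2) by (metis length_remove1)
  moreover have "sum_list L = x + sum_list (remove1 x L)" using assms(2) by (rule sum_list_map_remove1[of _ _ "\<lambda>x. x", simplified])
  ultimately show ?thesis using assms(3) by linarith
qed

lemma odd_length_iff_sum_list: "(\<And>r. r \<in> set L \<Longrightarrow> odd (r :: nat)) \<Longrightarrow> even (sum_list L) \<longleftrightarrow> even (length L)"
  by (induction L) auto

text \<open>The length is even, and some order is at least \<open>b\<close>, since \<open>a\<close>
  does not divide \<open>2 ^ n\<close>. Four orders would then total at least
  \<open>3 * a + b\<close>: this is where the bound of the theorem comes from.\<close>

lemma light_list_two:
  fixes a b n :: nat
  assumes "3 \<le> a" "a + 2 \<le> b" "n \<ge> 1"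
    and L: "\<And>r. r \<in> set L \<Longrightarrow> prime r \<and> odd r \<and> (r = a \<or> b \<le> r)"
    and "sum_list L = 2 ^ n" "2 ^ n < 3 * a + b"
  shows "\<exists>r s. L = [r, s] \<and> r \<noteq> s"
proof -
  have ndvd: "\<not> r dvd 2 ^ n" if "prime r" "odd r" for r :: nat
    using that prime_dvd_power_nat[of r 2 n] primes_dvd_imp_eq[of r 2] by auto
  have "even (length L)" using odd_length_iff_sum_list[of L] L assms(3,5) by auto
  have "\<exists>x\<in>set L. x \<noteq> a"
  proof (rule ccontr)
    assume "\<not> (\<exists>x\<in>set L. x \<noteq> a)"
    then have all: "\<forall>x\<in>set L. x = a" by blast
    then have "a dvd sum_list L" by (induction L) auto
    moreover obtain y where "y \<in> set L" using assms(5) by (cases L) auto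
    then have "prime a" "odd a" using L[of y] all by auto
    ultimately show False using ndvd assms(5) by simp
  qed
  then obtain x where x: "x \<in> set L" "b \<le> x" using L by blast
  have ge: "(length L - 1) * a + b \<le> sum_list L"
  proof (rule sum_list_ge_with_large[OF _ x])
    show "a \<le> r" if "r \<in> set L" for r using L[OF that] assms(2) by auto
  qed
  have "length L < 4"
  proof (rule ccontr)
    assume "\<not> length L < 4"
    then have "3 * a \<le> (length L - 1) * a" by (intro mult_right_mono) auto
    then show False using ge assms(5,6) by linarith
  qed
  moreover have "length L \<noteq> 0" using x(1) by auto
  ultimately have "length L = 2" using \<open>even (length L)\<close> by presburger
  then obtain r s where rs: "L = [r, s]" by (auto simp: numeral_2_eq_2 length_Suc_conv)
  moreover have "r \<noteq> s"
  proof
    assume "r = s"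
    then have "2 ^ n = r + r" using assms(5) rs by simp
    then have "r dvd 2 ^ n" by simp
    then show False using ndvd[of r] L[of r] rs by auto
  qed
  ultimately show ?thesis by blast
qed

text \<open>If the first coset is not the subgroup, oddness makes it disjoint from its negative,
  which by symmetry must lie in the second coset. Then one subgroup contains the other, impossible
  for distinct prime orders.\<close>

lemma symmetric_coset_pair_center:
  assumes "odd m" "prime r" "prime s" "r \<noteq> s" "r dvd m" "s dvd m"
    and w: "\<And>j. w j = coset_indicator m r g j + coset_indicator m s h j"
    and sym: "\<And>j. w (- j) = w j"
  shows "int (m div r) dvd g"
proof (rule ccontr)
  assume ng: "\<not> int (m div r) dvd g"
  define R where "R = int (m div r)"
  define S where "S = int (m div s)"
  have m0: "m > 0" using assms(1) by (cases m) auto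
  have "odd (m div r * r)" using assms(1,5) by simp
  then have "odd R" by (simp add: R_def)
  have *: "S dvd - j - h" if "R dvd j - g" for j
  proof -
    have "w j \<noteq> 0" using that by (simp add: w coset_indicator_def R_def)
    then have "R dvd - j - g \<or> S dvd - j - h"
      using sym[of j] by (auto simp: w coset_indicator_def R_def S_def split: if_splits)
    moreover have "\<not> R dvd - j - g"
    proof
      assume "R dvd - j - g"
      then have "R dvd (- j - g) + (j - g)" using that by (rule dvd_add)
      moreover have "(- j - g) + (j - g) = - (2 * g)" by simp
      ultimately have "R dvd 2 * g" by (simp only: dvd_minus_iff)
      then have "R dvd g" using \<open>odd R\<close> by (simp add: coprime_dvd_mult_right_iff)
      then show False using ng by (simp add: R_def)
    qed
    ultimately show ?thesis by blast
  qed
  \<comment> \<open>Two neighbouring elements \<open>g\<close> and \<open>g + R\<close> of the first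
    coset have their negatives in one coset modulo \<open>S\<close>.\<close>
  have "S dvd R" using dvd_diff[OF *[of g] *[of "g + R"]] by simp
  then obtain k where k: "m div r = (m div s) * k" by (auto simp: R_def S_def elim!: dvdE)
  then have "m div s * s = m div s * (k * r)" using assms(5,6)
    by (metis dvd_div_mult_self mult.assoc)
  moreover have "m div s > 0" using m0 assms(6) by (auto elim!: dvdE)
  ultimately have "r dvd s" by simp
  then show False using assms(2,3,4) primes_dvd_imp_eq by blast
qed

theorem light_symmetric_vanishing_sum:
  fixes a b m :: nat
  assumes m: "m > 0" "odd m" "3 \<le> a" "a + 2 \<le> b" "\<And>p. prime p \<Longrightarrow> p dvd m \<Longrightarrow> p = a \<or> b \<le> p"
    and w: "periodic m w" "\<And>j. 0 \<le> w j" "root_sum m w = 0" 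
    and n: "n \<ge> 1" "weight m w = 2 ^ n" "2 ^ n < 3 * a + b"
    and sym: "\<And>j. w (- j) = w j"
  shows "\<exists>r s. prime r \<and> prime s \<and> r \<noteq> s \<and> r dvd m \<and> s dvd m \<and>
    (\<forall>j. w j \<noteq> 0 \<longleftrightarrow> int (m div r) dvd j \<or> int (m div s) dvd j)"
proof -
  have "int (2 ^ n) < int (3 * a + b)" using n(3) by (simp only: of_nat_less_iff)
  then have light: "weight m w < 3 * int a + int b" using n(2) by simp
  obtain L where L: "\<forall>(r, g)\<in>set L. prime r \<and> r dvd m"
    "\<And>j. w j = (\<Sum>(r, g)\<leftarrow>L. coset_indicator m r g j)" "weight m w = int (\<Sum>(r, g)\<leftarrow>L. r)"
    using light_vanishing_sum_decomposition[OF m w light] by blast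
  have "\<exists>r s. map fst L = [r, s] \<and> r \<noteq> s"
  proof (rule light_list_two[OF m(3,4) n(1) _ _ n(3)])
    fix r assume "r \<in> set (map fst L)"
    then have "prime r" "r dvd m" using L(1) by auto
    then show "prime r \<and> odd r \<and> (r = a \<or> b \<le> r)" using m(2,5) by (auto elim: dvd_trans)
  next
    have "int (sum_list (map fst L)) = int (2 ^ n)" using L(3) n(2) by (simp add: case_prod_unfold)
    then show "sum_list (map fst L) = 2 ^ n" by (simp only: of_nat_eq_iff)
  qed
  then obtain r g s h where rs: "L = [(r, g), (s, h)]" "r \<noteq> s" by auto
  then have p: "prime r" "prime s" "r dvd m" "s dvd m" using L(1) by auto
  have w1: "w j = coset_indicator m r g j + coset_indicator m s h j" for j using L(2) rs by simp
  have R: "int (m div r) dvd g" by (rule symmetric_coset_pair_center[OF m(2) p(1,2) rs(2) p(3,4) w1 sym])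
  have w2: "w j = coset_indicator m s h j + coset_indicator m r g j" for j using w1 by simp
  have S: "int (m div s) dvd h"
    by (rule symmetric_coset_pair_center[OF m(2) p(2,1) rs(2)[symmetric] p(4,3) w2 sym])
  have "w j \<noteq> 0 \<longleftrightarrow> int (m div r) dvd j \<or> int (m div s) dvd j" for j
    using R S by (simp add: w1 coset_indicator_def dvd_diff_left_iff)
  then show ?thesis using p rs(2) by blast
qed

subsection \<open>Generalized bent functions\<close>

definition parity_sign :: "int \<Rightarrow> complex" where
  "parity_sign k = (if even k then 1 else - 1)"

lemma parity_sign_add: "parity_sign (i + j) = parity_sign i * parity_sign j"
  by (simp add: parity_sign_def)

lemma parity_sign_0 [simp]: "parity_sign 0 = 1"
  by (simp add: parity_sign_def)

lemma parity_sign_sum: "parity_sign (sum f A) = (\<Prod>i\<in>A. parity_sign (f i))"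
  by (induction A rule: infinite_finite_induct) (simp_all add: parity_sign_add)

lemma cnj_parity_sign [simp]: "cnj (parity_sign k) = parity_sign k"
  by (simp add: parity_sign_def)

lemma Z2vec_eq_PiE: "Z2vec n = {..<n} \<rightarrow>\<^sub>E {0, 1}"
proof -
  have "carrier (residue_ring 2) = {0, 1 :: int}" by (auto simp: residue_ring_def)
  then show ?thesis by (simp add: Z2vec_def)
qed

lemma finite_Z2vec [simp]: "finite (Z2vec n)"
  unfolding Z2vec_eq_PiE by (intro finite_PiE) auto

lemma card_Z2vec: "card (Z2vec n) = 2 ^ n"
  unfolding Z2vec_eq_PiE by (subst card_PiE) (auto simp: prod_constant numeral_2_eq_2)

text \<open>Orthogonality of characters, by factoring the sum over the coordinates.\<close>

lemma sum_Z2vec_parity_sign: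
  "(\<Sum>y\<in>Z2vec n. parity_sign (\<Sum>i<n. y i * z i)) = (if \<forall>i<n. even (z i) then 2 ^ n else 0)"
proof -
  have "(\<Sum>y\<in>Z2vec n. parity_sign (\<Sum>i<n. y i * z i)) = (\<Sum>y\<in>Z2vec n. \<Prod>i<n. parity_sign (y i * z i))"
    by (simp add: parity_sign_sum)
  also have "\<dots> = (\<Prod>i<n. \<Sum>c\<in>{0,1}. parity_sign (c * z i))"
    unfolding Z2vec_eq_PiE by (rule prod_sum_PiE[symmetric]) auto
  also have "\<dots> = (\<Prod>i<n. if even (z i) then 2 else 0)"
    by (intro prod.cong) (auto simp: parity_sign_def)
  also have "\<dots> = (if \<forall>i<n. even (z i) then 2 ^ n else 0)"
    by auto
  finally show ?thesis .
qed

definition vec_add :: "nat \<Rightarrow> (nat \<Rightarrow> int) \<Rightarrow> (nat \<Rightarrow> int) \<Rightarrow> nat \<Rightarrow> int" where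
  "vec_add n x a = (\<lambda>i\<in>{..<n}. (x i + a i) mod 2)"

lemma Z2vec_bit: "x \<in> Z2vec n \<Longrightarrow> i < n \<Longrightarrow> x i = 0 \<or> x i = 1"
  by (auto simp: Z2vec_eq_PiE PiE_iff)

lemma vec_add_in [simp]: "vec_add n x a \<in> Z2vec n"
  by (auto simp: Z2vec_eq_PiE vec_add_def)

lemma Z2vec_eqI:
  assumes "x \<in> Z2vec n" "y \<in> Z2vec n" "\<And>i. i < n \<Longrightarrow> x i = y i"
  shows "x = y"
  using assms by (auto simp: Z2vec_eq_PiE intro: PiE_ext)

text \<open>In characteristic 2 the relation is symmetric in the three vectors, and in this form it
  matches the condition produced by orthogonality.\<close>

lemma vec_add_eq_iff:
  assumes "x \<in> Z2vec n" "x' \<in> Z2vec n" "a \<in> Z2vec n"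
  shows "x' = vec_add n x a \<longleftrightarrow> (\<forall>i<n. even (x i + x' i + a i))"
proof
  assume ev: "\<forall>i<n. even (x i + x' i + a i)"
  show "x' = vec_add n x a"
  proof (rule Z2vec_eqI[OF assms(2) vec_add_in])
    fix i assume "i < n"
    then show "x' i = vec_add n x a i"
      using ev Z2vec_bit[OF assms(1)] Z2vec_bit[OF assms(2)] Z2vec_bit[OF assms(3)]
      by (fastforce simp: vec_add_def)
  qed
next
  assume "x' = vec_add n x a"
  then have "x' i = (x i + a i) mod 2" if "i < n" for i using that by (simp add: vec_add_def)
  moreover have "even (x i + (x i + a i) mod 2 + a i)" for i by presburger
  ultimately show "\<forall>i<n. even (x i + x' i + a i)" by simp
qed

lemma vec_add_vec_add:
  assumes "x \<in> Z2vec n" "a \<in> Z2vec n"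
  shows "vec_add n (vec_add n x a) a = x"
  using assms vec_add_eq_iff[OF assms(1) vec_add_in assms(2), of x a]
    vec_add_eq_iff[OF vec_add_in assms(1) assms(2), of x a]
  by (simp add: add.commute)

lemma zeta_powi: "zeta m powi k = uroot m k"
proof -
  have "zeta m = cis (2 * pi / real m)" by (simp add: zeta_def cis_conv_exp mult_ac)
  then show ?thesis by (simp add: uroot_def cis_power_int mult_ac)
qed

lemma cnj_uroot: "cnj (uroot m j) = uroot m (- j)"
  by (simp add: uroot_def cis_cnj)

lemma gbf_transform_eq:
  "gbf_transform m n f y = (\<Sum>x\<in>Z2vec n. uroot m (f x) * parity_sign (\<Sum>i<n. y i * x i))"
proof -
  have "(-1) powi inner2 n y x = parity_sign (\<Sum>i<n. y i * x i)" for x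
    by (simp add: inner2_def parity_sign_def even_iff_mod_2_eq_zero odd_iff_mod_2_eq_one)
  then show ?thesis by (simp add: gbf_transform_def zeta_powi)
qed

text \<open>The squared modulus of the transform is constant in \<open>y\<close>, so its Fourier
  coefficient at a nonzero \<open>a\<close> is zero; expanded, that coefficient is
  \<open>2 ^ n\<close> times the autocorrelation at \<open>a\<close>.\<close>

lemma gbf_autocorrelation:
  assumes f: "is_GBF m n f" and a: "a \<in> Z2vec n" "i0 < n" "a i0 \<noteq> 0"
  shows "(\<Sum>x\<in>Z2vec n. uroot m (f x - f (vec_add n x a))) = 0"
proof -
  let ?V = "Z2vec n"
  let ?\<chi> = "\<lambda>y x. parity_sign (\<Sum>i<n. y i * x i)"
  have F: "gbf_transform m n f y * cnj (gbf_transform m n f y) = 2 ^ n" if "y \<in> ?V" for y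
  proof -
    have "(cmod (gbf_transform m n f y))\<^sup>2 = 2 ^ n" using f that by (auto simp: is_GBF_def)
    then show ?thesis by (simp flip: complex_norm_square)
  qed
  have "odd (a i0)" using Z2vec_bit[OF a(1,2)] a(3) by auto
  then have "0 = (\<Sum>y\<in>?V. 2 ^ n * ?\<chi> y a)"
    using a(2) by (auto simp: sum_Z2vec_parity_sign simp flip: sum_distrib_left)
  also have "\<dots> = (\<Sum>y\<in>?V. gbf_transform m n f y * cnj (gbf_transform m n f y) * ?\<chi> y a)"
    by (simp add: F)
  also have "\<dots> = (\<Sum>y\<in>?V. \<Sum>x\<in>?V. \<Sum>x'\<in>?V. uroot m (f x - f x') * ?\<chi> y (\<lambda>i. x i + x' i + a i))"
  proof (rule sum.cong)
    fix y
    have "?\<chi> y (\<lambda>i. x i + x' i + a i) = ?\<chi> y x * ?\<chi> y x' * ?\<chi> y a" for x x' :: "nat \<Rightarrow> int"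
      by (simp add: distrib_left sum.distrib parity_sign_add)
    moreover have "uroot m (i - j) = uroot m i * uroot m (- j)" for i j
      using uroot_add[of m i "- j"] by simp
    moreover have "gbf_transform m n f y * cnj (gbf_transform m n f y) =
        (\<Sum>x\<in>?V. \<Sum>x'\<in>?V. (uroot m (f x) * ?\<chi> y x) * (uroot m (- f x') * ?\<chi> y x'))"
      by (simp add: gbf_transform_eq cnj_uroot sum_product)
    ultimately show "gbf_transform m n f y * cnj (gbf_transform m n f y) * ?\<chi> y a =
        (\<Sum>x\<in>?V. \<Sum>x'\<in>?V. uroot m (f x - f x') * ?\<chi> y (\<lambda>i. x i + x' i + a i))"
      by (simp only: sum_distrib_left sum_distrib_right mult_ac)
  qed simp
  also have "\<dots> = (\<Sum>x\<in>?V. \<Sum>y\<in>?V. \<Sum>x'\<in>?V. uroot m (f x - f x') * ?\<chi> y (\<lambda>i. x i + x' i + a i))"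
    by (rule sum.swap)
  also have "\<dots> = (\<Sum>x\<in>?V. \<Sum>x'\<in>?V. uroot m (f x - f x') * (\<Sum>y\<in>?V. ?\<chi> y (\<lambda>i. x i + x' i + a i)))"
    by (simp only: sum_distrib_left) (rule sum.cong[OF refl], rule sum.swap)
  also have "\<dots> = (\<Sum>x\<in>?V. \<Sum>x'\<in>?V. if x' = vec_add n x a then 2 ^ n * uroot m (f x - f x') else 0)"
    by (intro sum.cong) (auto simp: sum_Z2vec_parity_sign vec_add_eq_iff a(1))
  also have "\<dots> = 2 ^ n * (\<Sum>x\<in>?V. uroot m (f x - f (vec_add n x a)))"
    by (simp add: sum_distrib_left)
  finally show ?thesis by simp
qed

section \<open>The multiset of differences in a fixed direction\<close>

definition difference_count :: "nat \<Rightarrow> nat \<Rightarrow> ((nat \<Rightarrow> int) \<Rightarrow> int) \<Rightarrow> (nat \<Rightarrow> int) \<Rightarrow> int \<Rightarrow> int" where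
  "difference_count m n f a j = int (card {x \<in> Z2vec n. [f x - f (vec_add n x a) = j] (mod int m)})"

lemma sum_difference_count:
  fixes F :: "int \<Rightarrow> 'a :: comm_ring_1"
  assumes "m > 0" "periodic m F"
  shows "(\<Sum>j<m. of_int (difference_count m n f a (int j)) * F (int j)) =
    (\<Sum>x\<in>Z2vec n. F (f x - f (vec_add n x a)))"
proof -
  let ?d = "\<lambda>x. f x - f (vec_add n x a)"
  have "(\<Sum>j<m. of_int (difference_count m n f a (int j)) * F (int j)) =
      (\<Sum>j<m. \<Sum>x\<in>Z2vec n. if [?d x = int j] (mod int m) then F (int j) else 0)"
    by (simp add: difference_count_def sum.If_cases Int_def)
  also have "\<dots> = (\<Sum>x\<in>Z2vec n. \<Sum>j<m. if [?d x = int j] (mod int m) then F (int j) else 0)"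
    by (rule sum.swap)
  also have "\<dots> = (\<Sum>x\<in>Z2vec n. F (?d x))"
  proof (rule sum.cong)
    fix x
    define k where "k = nat (?d x mod int m)"
    have k: "k < m" "int k = ?d x mod int m" using assms(1) by (auto simp: k_def nat_less_iff)
    have "[?d x = int j] (mod int m) \<longleftrightarrow> j = k" if "j < m" for j
      using k that by (auto simp: cong_def)
    then have "(\<Sum>j<m. if [?d x = int j] (mod int m) then F (int j) else 0) =
        (\<Sum>j<m. if j = k then F (int k) else 0)"
      by (intro sum.cong) auto
    also have "\<dots> = F (int k)" using k by simp
    also have "\<dots> = F (?d x)" by (rule periodic_cong[OF assms(2)]) (simp add: k cong_def)
    finally show "(\<Sum>j<m. if [?d x = int j] (mod int m) then F (int j) else 0) = F (?d x)" .
  qed simp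
  finally show ?thesis .
qed

lemma periodic_difference_count: "periodic m (difference_count m n f a)"
  by (simp add: periodic_def difference_count_def cong_def)

lemma weight_difference_count:
  assumes "m > 0"
  shows "weight m (difference_count m n f a) = 2 ^ n"
  using sum_difference_count[OF assms, of "\<lambda>_. 1 :: int" n f a]
  by (simp add: weight_def periodic_def card_Z2vec)

lemma root_sum_difference_count:
  assumes "m > 0"
  shows "root_sum m (difference_count m n f a) = (\<Sum>x\<in>Z2vec n. uroot m (f x - f (vec_add n x a)))"
  unfolding root_sum_def by (rule sum_difference_count[OF assms periodic_uroot[OF assms]])

text \<open>The involution adding \<open>a\<close> swaps \<open>x\<close> with its partner and
  negates the difference.\<close>

lemma difference_count_minus:
  assumes "a \<in> Z2vec n"
  shows "difference_count m n f a (- j) = difference_count m n f a j"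
proof -
  let ?S = "\<lambda>j. {x \<in> Z2vec n. [f x - f (vec_add n x a) = j] (mod int m)}"
  have flip: "[- i = - k] (mod int m) \<longleftrightarrow> [i = k] (mod int m)" for i k by (rule cong_minus_minus_iff)
  have "bij_betw (\<lambda>x. vec_add n x a) (?S (- j)) (?S j)"
  proof (rule bij_betwI[where g = "\<lambda>x. vec_add n x a"])
    have "vec_add n x a \<in> ?S (- j)" if "x \<in> ?S j" for x j
      using that assms flip[of "f x - f (vec_add n x a)" j] by (simp add: vec_add_vec_add)
    from this[of _ j] this[of _ "- j"]
    show "(\<lambda>x. vec_add n x a) \<in> ?S (- j) \<rightarrow> ?S j" "(\<lambda>x. vec_add n x a) \<in> ?S j \<rightarrow> ?S (- j)" by auto
  qed (use assms in \<open>auto simp: vec_add_vec_add\<close>)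
  then show ?thesis unfolding difference_count_def by (simp add: bij_betw_same_card)
qed

lemma div_dvd_iff_dvd_mult:
  fixes m r :: nat
  assumes "r dvd m" "r > 0"
  shows "int (m div r) dvd j \<longleftrightarrow> int m dvd int r * j"
proof -
  have "int m = int r * int (m div r)" using assms by (metis dvd_mult_div_cancel of_nat_mult)
  then show ?thesis using assms(2) by simp
qed

text \<open>Each direction brings its own pair of primes. The work is to show that, for the chosen
  direction, the single prime \<open>r\<close> kills all differences from one point
  \<open>u\<close>.\<close>

theorem no_light_GBF:
  fixes a b m n :: nat
  assumes m: "m > 0" "odd m" "3 \<le> a" "a + 2 \<le> b" "\<And>p. prime p \<Longrightarrow> p dvd m \<Longrightarrow> p = a \<or> b \<le> p"
    and n: "n \<ge> 1" "2 ^ n < 3 * a + b" and f: "is_GBF m n f"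
  shows False
proof -
  let ?w = "difference_count m n f"
  have key: "\<exists>r s. prime r \<and> prime s \<and> r \<noteq> s \<and> r dvd m \<and> s dvd m \<and>
      (\<forall>j. ?w c j \<noteq> 0 \<longleftrightarrow> int (m div r) dvd j \<or> int (m div s) dvd j)"
    if c: "c \<in> Z2vec n" "i < n" "c i \<noteq> 0" for c i
  proof -
    have rs: "root_sum m (?w c) = 0"
      using root_sum_difference_count[OF m(1)] gbf_autocorrelation[OF f c] by simp
    have w0: "0 \<le> ?w c j" for j by (simp add: difference_count_def)
    show ?thesis
      by (rule light_symmetric_vanishing_sum[OF m periodic_difference_count w0 rs n(1)
          weight_difference_count[OF m(1)] n(2) difference_count_minus[OF c(1)]])
  qed
  have witness: "\<exists>x\<in>Z2vec n. int m dvd f x - f (vec_add n x c) - j" if nz: "?w c j \<noteq> 0" for c j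
  proof -
    have "{x \<in> Z2vec n. [f x - f (vec_add n x c) = j] (mod int m)} \<noteq> {}"
      using nz unfolding difference_count_def by (metis card.empty of_nat_0)
    then show ?thesis by (auto simp: cong_iff_dvd_diff)
  qed
  have all: "\<exists>q. prime q \<and> int m dvd int q * (f x - f x')" if x: "x \<in> Z2vec n" "x' \<in> Z2vec n" for x x'
  proof (cases "x = x'")
    case True
    \<comment> \<open>The difference is zero, so any prime will do.\<close>
    then show ?thesis using two_is_prime_nat by (intro exI[of _ 2]) simp
  next
    case False
    define c where "c = vec_add n x x'"
    have c: "c \<in> Z2vec n" by (simp add: c_def)
    have x': "x' = vec_add n x c"
      using vec_add_eq_iff[OF x(1) c x(2)] vec_add_eq_iff[OF x(1) x(2) c] by (auto simp: c_def algebra_simps)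
    obtain i where i: "i < n" "c i \<noteq> 0"
    proof (rule ccontr)
      assume "\<not> thesis"
      then have "\<forall>i<n. c i = 0" using that by blast
      then have "x i = x' i" if "i < n" for i
        using that Z2vec_bit[OF x(1) that] Z2vec_bit[OF x(2) that] by (auto simp: c_def vec_add_def)
      then show False using False Z2vec_eqI[OF x] by blast
    qed
    obtain r s where rs: "prime r" "prime s" "r dvd m" "s dvd m"
      "\<And>j. ?w c j \<noteq> 0 \<Longrightarrow> int (m div r) dvd j \<or> int (m div s) dvd j"
      using key[OF c i] by blast
    have "x \<in> {x \<in> Z2vec n. [f x - f (vec_add n x c) = f x - f x'] (mod int m)}" using x x' by simp
    then have "?w c (f x - f x') \<noteq> 0" unfolding difference_count_def by (auto simp: card_gt_0_iff)
    then have "int m dvd int r * (f x - f x') \<or> int m dvd int s * (f x - f x')"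
      using rs div_dvd_iff_dvd_mult prime_gt_0_nat by blast
    then show ?thesis using rs by blast
  qed
  \<comment> \<open>The first unit vector, as some nonzero direction.\<close>
  define c where "c = (\<lambda>i\<in>{..<n}. if i = 0 then 1 else 0 :: int)"
  have c: "c \<in> Z2vec n" "0 < n" "c 0 \<noteq> 0" using n(1) by (auto simp: c_def Z2vec_eq_PiE)
  obtain r s where rs: "prime r" "prime s" "r \<noteq> s" "r dvd m" "s dvd m"
    "\<And>j. ?w c j \<noteq> 0 \<longleftrightarrow> int (m div r) dvd j \<or> int (m div s) dvd j"
    using key[OF c] by blast
  define R where "R = int (m div r)"
  define S where "S = int (m div s)"
  have mR: "int r * R = int m" and mS: "int s * S = int m"
    using rs(4,5) by (auto simp: R_def S_def simp flip: of_nat_mult)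
  have R0: "R \<noteq> 0" and S0: "S \<noteq> 0" using mR mS m(1) by auto
  \<comment> \<open>\<open>R\<close> and \<open>S\<close> lie in the two subgroups, so both occur as
    differences in direction \<open>c\<close>.\<close>
  obtain x where x: "x \<in> Z2vec n" "int m dvd f x - f (vec_add n x c) - R"
    using witness[of c R] rs(6) by (auto simp: R_def)
  obtain y where y: "y \<in> Z2vec n" "int m dvd f y - f (vec_add n y c) - S"
    using witness[of c S] rs(6) by (auto simp: S_def)
  define u where "u = f (vec_add n x c)"
  have xR: "int m dvd f x - u - R" using x(2) by (simp add: u_def)
  have uR: "int m dvd int r * (f x - u)"
  proof -
    have "int m dvd int r * (f x - u - R) + int r * R"
      by (rule dvd_add[OF dvd_mult[OF xR]]) (simp add: mR)
    then show ?thesis by (simp add: algebra_simps)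
  qed
  \<comment> \<open>If \<open>f z - f x\<close> and \<open>f z - u\<close> are killed by the primes \<open>q1\<close> and \<open>q2\<close>, then \<open>R\<close> is killed by
    \<open>q1 * q2\<close>, so \<open>r\<close> is one of them.\<close>
  have near: "int m dvd int r * (f z - u)" if z: "z \<in> Z2vec n" for z
  proof -
    obtain q1 where q1: "prime q1" "int m dvd int q1 * (f z - f x)" using all[OF z x(1)] by blast
    obtain q2 where q2: "prime q2" "int m dvd int q2 * (f z - u)" using all[OF z vec_add_in] by (auto simp: u_def)
    \<comment> \<open>The combination cancels to \<open>q1 * q2 * R\<close>, because
      \<open>f x - u\<close> is congruent to \<open>R\<close>.\<close>
    have "int m dvd int q1 * (int q2 * (f z - u)) - int q2 * (int q1 * (f z - f x)) - int q1 * int q2 * (f x - u - R)"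
      by (rule dvd_diff[OF dvd_diff[OF dvd_mult[OF q2(2)] dvd_mult[OF q1(2)]] dvd_mult[OF xR]])
    then have "int m dvd int q1 * int q2 * R" by (simp add: algebra_simps)
    then have "int r dvd int q1 * int q2" using R0 unfolding mR[symmetric] by simp
    then have "r dvd q1 * q2" by (simp flip: of_nat_mult)
    then have "r = q1 \<or> r = q2" using rs(1) q1(1) q2(1) primes_dvd_imp_eq prime_dvd_mult_iff by blast
    then show ?thesis
    proof
      assume "r = q1"
      then have "int m dvd int r * (f z - f x) + int r * (f x - u)" using q1 uR by (intro dvd_add) auto
      then show ?thesis by (simp add: algebra_simps)
    qed (use q2 in simp)
  qed
  \<comment> \<open>Both ends of the difference \<open>S\<close> are close to \<open>u\<close>, so
    \<open>r\<close> kills \<open>S\<close>, which has order \<open>s\<close>.\<close>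
  have "int m dvd int r * (f y - u) - int r * (f (vec_add n y c) - u) - int r * (f y - f (vec_add n y c) - S)"
    by (rule dvd_diff[OF dvd_diff[OF near[OF y(1)] near[OF vec_add_in]] dvd_mult[OF y(2)]])
  then have "int m dvd int r * S" by (simp add: algebra_simps)
  then have "int s dvd int r" using S0 unfolding mS[symmetric] by simp
  then show False using rs(1-3) primes_dvd_imp_eq by auto
qed

theorem theorem3p4:
  fixes n m s :: nat and p \<alpha> :: "nat \<Rightarrow> nat"
  assumes "n \<ge> 1" and "s \<ge> 1"
    and "\<And>i. i \<in> {1..s} \<Longrightarrow> prime (p i) \<and> odd (p i)"
    and "3 \<le> p 1" and "strict_mono_on {1..s} p"
    and "\<And>i. i \<in> {1..s} \<Longrightarrow> \<alpha> i > 0"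
    and "m = (\<Prod>i=1..s. p i ^ \<alpha> i)"
    and "\<exists>f. is_GBF m n f"
  shows "s \<ge> 2 \<and> 3 * p 1 + p 2 \<le> 2 ^ n"
proof -
  obtain f where f: "is_GBF m n f" using assms(8) by blast
  have m0: "m > 0" unfolding assms(7) using assms(3) prime_gt_0_nat by (intro prod_pos) auto
  have om: "odd m" unfolding assms(7) using assms(3) by (auto simp: even_prod_iff)
  have pr: "\<exists>i\<in>{1..s}. q = p i" if q: "prime q" "q dvd m" for q
  proof -
    obtain i where "i \<in> {1..s}" "q dvd p i ^ \<alpha> i"
      using q unfolding assms(7) by (auto simp: prime_dvd_prod_iff)
    then show ?thesis using q(1) assms(3) prime_dvd_power primes_dvd_imp_eq by blast
  qed
  have s2: "s \<ge> 2"
  proof (rule ccontr)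
    assume "\<not> s \<ge> 2"
    then have "i = 1" if "i \<in> {1..s}" for i using that by auto
    \<comment> \<open>With no second prime, \<open>b\<close> is free; this value is large enough for
      \<open>a + 2 \<le> b\<close> and \<open>2 ^ n < 3 * a + b\<close>.\<close>
    then have "q = p 1 \<or> 2 ^ n + p 1 + 2 \<le> q" if "prime q" "q dvd m" for q
      using pr[OF that] by blast
    from no_light_GBF[OF m0 om assms(4) _ this assms(1) _ f] show False by simp
  qed
  have less: "p i < p j" if "1 \<le> i" "i < j" "j \<le> s" for i j
    using strict_mono_onD[OF assms(5), of i j] that by auto
  have "p 1 < p 2" "odd (p 1)" "odd (p 2)" using less[of 1 2] s2 assms(3) by auto
  then have gap: "p 1 + 2 \<le> p 2" by presburger
  have "q = p 1 \<or> p 2 \<le> q" if q: "prime q" "q dvd m" for q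
  proof -
    obtain i where i: "i \<in> {1..s}" "q = p i" using pr[OF q] by blast
    consider "i = 1" | "i = 2" | "i > 2" using i(1) by force
    then show ?thesis using i less[of 2 i] by cases auto
  qed
  from no_light_GBF[OF m0 om assms(4) gap this assms(1) _ f] have "\<not> 2 ^ n < 3 * p 1 + p 2" by blast
  then show ?thesis using s2 by simp
qed

end
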